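(* Let $q$ be a prime power, let $N,D$ be integers with $D\ge3$, $N\ge2D$, let $C$ be a Delsarte clique of the Grassmann graph $\Gamma=J_q(N,D)$ and $x\in C$. Let $M$ be the Bose–Mesner algebra of $\Gamma$, let $\mathbf W=\mathrm{span}\{\hat C^\pm_i\}_{i=0}^{D-1}\subseteq\mathbb C^X$, let $\pi$ be the orthogonal projection from $\mathbf W$ onto $M\hat x$, and let $\widetilde\pi$ be the orthogonal projection from $\mathbf W$ onto $M\hat C$. Let $\mathcal T,\mathcal T'$ act on $\mathbf W$ via the $\mathcal H_{\mathrm V}$-module structure, with $k=\sqrt{-1}q^{(D-N-1)/2}$, $k'=\sqrt{-1}q^{-D/2}$. Then on $\mathbf W$, $$\pi=\frac{\mathcal T'+k'^{-1}}{k'+k'^{-1}},\qquad \widetilde\pi=\frac{\mathcal T+k^{-1}}{k+k^{-1}}.$$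
   Context: $\Gamma=J_q(N,D)$ has as vertex set $X$ all $D$-dimensional subspaces of an $N$-dimensional vector space over $\mathbb F_q$, adjacency meaning intersection of dimension $D-1$; $\partial$ is path-length distance. A Delsarte clique is a clique of size $\frac{q^{N-D+1}-1}{q-1}$ (attaining the Hoffman bound). For $0\le i\le D-1$: $C_i=\{y\in X:\min_{z\in C}\partial(y,z)=i\}$, $C^-_i=\{y\in C_i:\partial(x,y)=i\}$, $C^+_i=\{y\in C_i:\partial(x,y)=i+1\}$ (all nonempty, partitioning $X$). $\hat Y\in\mathbb C^X$ is the characteristic vector of $Y\subseteq X$, $\hat x$ that of $\{x\}$; $\mathbb C^X$ carries the standard Hermitian inner product. The Bose–Mesner algebra $M$ is the subalgebra of $\mathrm{Mat}_X(\mathbb C)$ generated by the adjacency matrix; it is spanned by the distance matrices $A_0,\dots,A_D$. Both $M\hat x$ and $M\hat C$ are contained in $\mathbf W$. Action of $\mathcal T,\mathcal T'$ (two of the generators of the confluent Cherednik algebra $\mathcal H_{\mathrm V}$ acting on $\mathbf W$; only their action is needed). With respect to the ordered basis $\hat C^-_0,\hat C^+_0,\hat C^-_1,\hat C^+_1,\dots,\hat C^-_{D-1},\hat C^+_{D-1}$ of $\mathbf W$ (columns = images of basis vectors), $\mathcal T$ acts as $\mathrm{blockdiag}[t(0),\dots,t(D-1)]$ and $\mathcal T'$ acts as $\mathrm{blockdiag}[t'(0),t'(1),\dots,t'(D)]$, where $$t(i)=k\begin{bmatrix}1-q^{i+1}+q^{N-D+1}& q^{N-D+1}(q^{D-N+i}-1)\\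 1-q^{i+1}&q^{i+1}\end{bmatrix}\ (0\le i\le D-1),\qquad t'(i)=k'\begin{bmatrix}1-q^i+q^D&q^i-q^D\\1-q^i&q^i\end{bmatrix}\ (1\le i\le D-1),$$ and $t'(0)=t'(D)=[k']$ are $1\times1$. *)

theory Defs
  imports "HOL-Analysis.Analysis"
begin

section \<open>Grassmann graphs\<close>

text \<open>The ambient space is the coordinate space of dimension \<open>N = CARD('n)\<close> over a finite field
  with \<open>q = CARD('f)\<close> elements.\<close>

definition grass_vertices :: "nat \<Rightarrow> ('f::field ^ 'n) set set" where
  "grass_vertices D = {U. vec.subspace U \<and> vec.dim U = D}"

definition grass_edges :: "nat \<Rightarrow> (('f::field ^ 'n) set \<times> ('f ^ 'n) set) set" where
  "grass_edges D =
     {(U, V). U \<in> grass_vertices D \<and> V \<in> grass_vertices D \<and> vec.dim (U \<inter> V) + 1 = D}"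

definition path_dist :: "('v \<times> 'v) set \<Rightarrow> 'v \<Rightarrow> 'v \<Rightarrow> nat" where
  "path_dist E y z = (LEAST n. (y, z) \<in> E ^^ n)"

definition delsarte_clique :: "nat \<Rightarrow> ('f::{field,finite} ^ 'n) set set \<Rightarrow> bool" where
  "delsarte_clique D C \<longleftrightarrow>
     C \<subseteq> grass_vertices D \<and>
     (\<forall>y\<in>C. \<forall>z\<in>C. y \<noteq> z \<longrightarrow> (y, z) \<in> grass_edges D) \<and>
     real (card C) = (real CARD('f) ^ (CARD('n) - D + 1) - 1) / (real CARD('f) - 1)"

definition cell :: "nat \<Rightarrow> ('f::{field,finite} ^ 'n) set set \<Rightarrow> nat \<Rightarrow> ('f ^ 'n) set set" where
  "cell D C i = {y \<in> grass_vertices D. Min (path_dist (grass_edges D) y ` C) = i}"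

definition cell_minus ::
  "nat \<Rightarrow> ('f::{field,finite} ^ 'n) set set \<Rightarrow> ('f ^ 'n) set \<Rightarrow> nat \<Rightarrow> ('f ^ 'n) set set" where
  "cell_minus D C x i = {y \<in> cell D C i. path_dist (grass_edges D) x y = i}"

definition cell_plus ::
  "nat \<Rightarrow> ('f::{field,finite} ^ 'n) set set \<Rightarrow> ('f ^ 'n) set \<Rightarrow> nat \<Rightarrow> ('f ^ 'n) set set" where
  "cell_plus D C x i = {y \<in> cell D C i. path_dist (grass_edges D) x y = i + 1}"

section \<open>Vectors and matrices indexed by a vertex set\<close>

text \<open>For a vertex set \<open>X\<close> inside a finite type \<open>'v\<close>, the space of complex vectors indexed by
  \<open>X\<close> is realised as the vectors in \<open>complex ^ 'v\<close> that vanish outside \<open>X\<close>; likewise the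
  \<open>X \<times> X\<close> matrices are those in \<open>complex ^ 'v ^ 'v\<close> that vanish outside \<open>X \<times> X\<close>. This
  extension by zero preserves products, the action on vectors and the Hermitian inner product, but
  the identity of the matrix algebra becomes \<open>id_matrix X\<close> rather than \<open>mat 1\<close>.\<close>

definition char_vec :: "'v set \<Rightarrow> complex ^ 'v" where
  "char_vec Y = (\<chi> y. of_bool (y \<in> Y))"

definition id_matrix :: "'v set \<Rightarrow> complex ^ 'v ^ 'v" where
  "id_matrix X = (\<chi> y z. of_bool (y = z \<and> y \<in> X))"

definition adj_matrix :: "('v \<times> 'v) set \<Rightarrow> complex ^ 'v ^ 'v" where
  "adj_matrix E = (\<chi> y z. of_bool ((y, z) \<in> E))"

inductive_set bose_mesner ::
  "'v::finite set \<Rightarrow> ('v \<times> 'v) set \<Rightarrow> (complex ^ 'v ^ 'v) set"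
  for X :: "'v set" and E :: "('v \<times> 'v) set" where
  one: "id_matrix X \<in> bose_mesner X E"
| adj: "adj_matrix E \<in> bose_mesner X E"
| add: "A \<in> bose_mesner X E \<Longrightarrow> B \<in> bose_mesner X E \<Longrightarrow> A + B \<in> bose_mesner X E"
| scale: "A \<in> bose_mesner X E \<Longrightarrow> (\<chi> y z. c * A $ y $ z) \<in> bose_mesner X E"
| mult: "A \<in> bose_mesner X E \<Longrightarrow> B \<in> bose_mesner X E \<Longrightarrow> A ** B \<in> bose_mesner X E"

definition hermitian_inner :: "complex ^ 'v::finite \<Rightarrow> complex ^ 'v \<Rightarrow> complex" where
  "hermitian_inner u v = (\<Sum>y\<in>UNIV. u $ y * cnj (v $ y))"

text \<open>Meaningful when \<open>S\<close> is a complex subspace, in which case the point \<open>p\<close> exists and is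
  unique.\<close>

definition orth_proj :: "(complex ^ 'v::finite) set \<Rightarrow> complex ^ 'v \<Rightarrow> complex ^ 'v" where
  "orth_proj S w = (THE p. p \<in> S \<and> (\<forall>s\<in>S. hermitian_inner (w - p) s = 0))"

section \<open>The space \<open>W\<close> and the two operators on it\<close>

definition grass_bose_mesner ::
  "nat \<Rightarrow> (complex ^ ('f::{field,finite} ^ 'n) set ^ ('f ^ 'n) set) set" where
  "grass_bose_mesner D = bose_mesner (grass_vertices D) (grass_edges D)"

definition module_generated ::
  "(complex ^ 'v ^ 'v) set \<Rightarrow> complex ^ 'v::finite \<Rightarrow> (complex ^ 'v) set" where
  "module_generated M v = (\<lambda>A. A *v v) ` M"

definition W_space ::
  "nat \<Rightarrow> ('f::{field,finite} ^ 'n) set set \<Rightarrow> ('f ^ 'n) set \<Rightarrow> (complex ^ ('f ^ 'n) set) set" where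
  "W_space D C x =
     vec.span (\<Union>i<D. {char_vec (cell_minus D C x i), char_vec (cell_plus D C x i)})"

definition linear_endo_on :: "(complex ^ 'v) set \<Rightarrow> (complex ^ 'v \<Rightarrow> complex ^ 'v) \<Rightarrow> bool" where
  "linear_endo_on S f \<longleftrightarrow>
     (\<forall>u\<in>S. f u \<in> S) \<and>
     (\<forall>u\<in>S. \<forall>v\<in>S. f (u + v) = f u + f v) \<and>
     (\<forall>c. \<forall>u\<in>S. f (c *s u) = c *s f u)"

text \<open>\<open>f\<close> acts on the ordered pair \<open>u, v\<close> by the matrix \<open>B\<close>, whose columns give the images.\<close>

definition acts_by_block ::
  "(complex ^ 'v \<Rightarrow> complex ^ 'v) \<Rightarrow> complex ^ 2 ^ 2 \<Rightarrow> complex ^ 'v \<Rightarrow> complex ^ 'v \<Rightarrow> bool" where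
  "acts_by_block f B u v \<longleftrightarrow>
     f u = B $ 1 $ 1 *s u + B $ 2 $ 1 *s v \<and>
     f v = B $ 1 $ 2 *s u + B $ 2 $ 2 *s v"

definition t_block :: "nat \<Rightarrow> nat \<Rightarrow> nat \<Rightarrow> complex \<Rightarrow> nat \<Rightarrow> complex ^ 2 ^ 2" where
  "t_block q N D k i = (let Q = complex_of_nat q in
     vector [vector [k * (1 - Q ^ (i + 1) + Q ^ (N - D + 1)),
                     k * (Q ^ (N - D + 1) * (Q powi (int D - int N + int i) - 1))],
             vector [k * (1 - Q ^ (i + 1)),
                     k * Q ^ (i + 1)]])"

definition t'_block :: "nat \<Rightarrow> nat \<Rightarrow> complex \<Rightarrow> nat \<Rightarrow> complex ^ 2 ^ 2" where
  "t'_block q D k' i = (let Q = complex_of_nat q in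
     vector [vector [k' * (1 - Q ^ i + Q ^ D), k' * (Q ^ i - Q ^ D)],
             vector [k' * (1 - Q ^ i), k' * Q ^ i]])"

text \<open>In the ordered basis \<open>C\<^sup>-\<^sub>0, C\<^sup>+\<^sub>0, C\<^sup>-\<^sub>1, \<dots>, C\<^sup>+\<^bsub>D-1\<^esub>\<close>, the blocks \<open>t(i)\<close> pair
  \<open>C\<^sup>-\<^sub>i\<close> with \<open>C\<^sup>+\<^sub>i\<close>, whereas the blocks \<open>t'(i)\<close> with \<open>1 \<le> i \<le> D - 1\<close> pair
  \<open>C\<^sup>+\<^bsub>i-1\<^esub>\<close> with \<open>C\<^sup>-\<^sub>i\<close>, leaving the first and the last basis vector to the two
  \<open>1 \<times> 1\<close> blocks.\<close>

definition is_T_action ::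
  "nat \<Rightarrow> ('f::{field,finite} ^ 'n) set set \<Rightarrow> ('f ^ 'n) set \<Rightarrow> complex \<Rightarrow>
   (complex ^ ('f ^ 'n) set \<Rightarrow> complex ^ ('f ^ 'n) set) \<Rightarrow> bool" where
  "is_T_action D C x k T \<longleftrightarrow>
     linear_endo_on (W_space D C x) T \<and>
     (\<forall>i<D. acts_by_block T (t_block CARD('f) CARD('n) D k i)
              (char_vec (cell_minus D C x i)) (char_vec (cell_plus D C x i)))"

definition is_T'_action ::
  "nat \<Rightarrow> ('f::{field,finite} ^ 'n) set set \<Rightarrow> ('f ^ 'n) set \<Rightarrow> complex \<Rightarrow>
   (complex ^ ('f ^ 'n) set \<Rightarrow> complex ^ ('f ^ 'n) set) \<Rightarrow> bool" where
  "is_T'_action D C x k' T' \<longleftrightarrow>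
     linear_endo_on (W_space D C x) T' \<and>
     T' (char_vec (cell_minus D C x 0)) = k' *s char_vec (cell_minus D C x 0) \<and>
     (\<forall>i\<in>{1..D-1}. acts_by_block T' (t'_block CARD('f) D k' i)
              (char_vec (cell_plus D C x (i - 1))) (char_vec (cell_minus D C x i))) \<and>
     T' (char_vec (cell_plus D C x (D - 1))) = k' *s char_vec (cell_plus D C x (D - 1))"

end

theory Submission imports Defs begin

text \<open>Up to duality there is one kind of Delsarte clique \<open>C\<close>: all \<open>D\<close>-subspaces containing a fixed
  \<open>(D - 1)\<close>-subspace \<open>S\<close>; if \<open>N = 2 D\<close> there are also the cliques of all \<open>D\<close>-subspaces of a fixed
  \<open>(D + 1)\<close>-subspace \<open>S\<close>. In either case \<open>M x\<close> and \<open>M C\<close> are spanned by the characteristic vectors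
  of the sets \<open>{y. dim (y \<inter> S) = j}\<close> (with \<open>x\<close> in place of \<open>S\<close> for \<open>M x\<close>), since the general linear
  group acts transitively on pairs of subspaces with prescribed dimensions. Each such set is the
  disjoint union of at most two of the cells \<open>C\<^sub>i\<^sup>-, C\<^sub>i\<^sup>+\<close>, so the orthogonal projections are block diagonal
  with entries given by the proportions of the cells. These proportions follow from the same
  transitivity by counting incident pairs (vector, subspace), and agree with the entries of the
  blocks \<open>t'(i)\<close> and \<open>t(i)\<close> after the affine normalisation.\<close>

section \<open>Subspaces over a finite field\<close>

text \<open>The subspaces \<open>S\<close> and \<open>x\<close> are nested with dimensions differing
  by one: \<open>S\<close> is a hyperplane of \<open>x\<close> when the clique consists of subspaces
  through \<open>S\<close>, and \<open>x\<close> is a hyperplane of \<open>S\<close> when it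
  consists of subspaces inside \<open>S\<close>. A vertex therefore meets the larger of the two in
  at most one dimension more than the smaller, so the two families of layers interleave. This zigzag
  is the staggered pairing of the cells by the blocks t(i) and t'(i). Two proportions are needed,
  one inside a layer of the larger subspace and one inside a layer of the smaller; the two kinds of
  clique exchange their roles. The definition of a Delsarte clique does not mention
  \<open>S\<close>. It has to be recovered from the cardinality: the extremal size forces the clique
  to be a full family, and excludes the second kind unless N = 2 D.\<close>

abbreviation (input) flinear :: "('f::field ^ 'n \<Rightarrow> 'f ^ 'n) \<Rightarrow> bool" where
  "flinear g \<equiv> Vector_Spaces.linear (*s) (*s) g"

lemma card_span_independent:
  fixes B :: "('f::{field,finite} ^ 'n) set"
  assumes "vec.independent B"
  shows "card (vec.span B) = CARD('f) ^ card B"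
proof -
  have "finite B" by simp
  then show ?thesis using assms
  proof (induction B)
    case empty
    then show ?case by simp
  next
    case (insert a B)
    then have a: "a \<notin> vec.span B" and ind: "vec.independent B"
      by (auto simp: vec.independent_insert)
    let ?h = "\<lambda>(k, s). k *s a + s"
    have "bij_betw ?h (UNIV \<times> vec.span B) (vec.span (insert a B))"
      unfolding bij_betw_def
    proof
      show "inj_on ?h (UNIV \<times> vec.span B)"
      proof (rule inj_onI, clarify)
        fix k s k' s'
        assume s: "s \<in> vec.span B" "s' \<in> vec.span B" and e: "k *s a + s = k' *s a + s'"
        have "(k - k') *s a = s' - s"
          using e by (simp add: vec.scale_left_diff_distrib algebra_simps)
        then have m: "(k - k') *s a \<in> vec.span B"
          using s by (simp add: vec.span_diff)
        have "k = k'"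
        proof (rule ccontr)
          assume "k \<noteq> k'"
          then have "a = inverse (k - k') *s ((k - k') *s a)"
            by (simp only: vec.scale_scale) simp
          then show False using m a by (metis vec.span_scale)
        qed
        then show "k = k' \<and> s = s'" using e by simp
      qed
      show "?h ` (UNIV \<times> vec.span B) = vec.span (insert a B)"
      proof (intro subset_antisym subsetI)
        fix v assume "v \<in> vec.span (insert a B)"
        then obtain k where "v - k *s a \<in> vec.span B" by (auto simp: vec.span_insert)
        then show "v \<in> ?h ` (UNIV \<times> vec.span B)"
          by (intro image_eqI[of _ _ "(k, v - k *s a)"]) auto
      next
        fix v assume "v \<in> ?h ` (UNIV \<times> vec.span B)"
        then obtain k s where "v = k *s a + s" "s \<in> vec.span B" by auto
        then have "v - k *s a \<in> vec.span B" by simp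
        then show "v \<in> vec.span (insert a B)" by (auto simp: vec.span_insert)
      qed
    qed
    then have "card (vec.span (insert a B)) = card ((UNIV :: 'f set) \<times> vec.span B)"
      using bij_betw_same_card by metis
    then show ?case using insert ind by (simp add: card_cartesian_product)
  qed
qed

lemma card_subspace:
  fixes U :: "('f::{field,finite} ^ 'n) set"
  assumes "vec.subspace U"
  shows "card U = CARD('f) ^ vec.dim U"
proof -
  obtain B where B: "B \<subseteq> U" "vec.independent B" "U \<subseteq> vec.span B" "card B = vec.dim U"
    by (rule vec.basis_exists)
  have "vec.span B = U" using B assms by (simp add: vec.span_subspace)
  then show ?thesis using card_span_independent[OF B(2)] B(4) by simp
qed

text \<open>Extend a basis of \<open>M\<close> to one of \<open>U\<close> and delete one of the
  added vectors.\<close>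

lemma ex_hyperplane_containing:
  fixes M U :: "('f::field ^ 'n) set"
  assumes "vec.subspace M" "vec.subspace U" "M \<subseteq> U" "M \<noteq> U"
  shows "\<exists>H. vec.subspace H \<and> M \<subseteq> H \<and> H \<subseteq> U \<and> vec.dim H + 1 = vec.dim U"
proof -
  obtain B0 where B0: "B0 \<subseteq> M" "vec.independent B0" "M \<subseteq> vec.span B0" "card B0 = vec.dim M"
    by (rule vec.basis_exists)
  obtain B where B: "B0 \<subseteq> B" "B \<subseteq> U" "vec.independent B" "U \<subseteq> vec.span B"
    by (rule vec.maximal_independent_subset_extend[of B0 U]) (use B0 assms in auto)
  have "B \<noteq> B0"
    using B(4) vec.span_minimal[OF B0(1) assms(1)] assms(3,4) by auto
  then obtain b where b: "b \<in> B" "b \<notin> B0" using B by blast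
  let ?H = "vec.span (B - {b})"
  have "vec.dim U = card B" using B by (simp add: vec.basis_card_eq_dim)
  moreover have "vec.independent (B - {b})" using B(3) vec.independent_mono by blast
  then have "vec.dim ?H = card (B - {b})" by (simp add: vec.dim_span_eq_card_independent del: vec.dim_span)
  moreover have "card (B - {b}) + 1 = card B"
    using b(1) vec.finiteI_independent[OF B(3)] by (metis Suc_eq_plus1 card_Suc_Diff1)
  moreover have "M \<subseteq> ?H"
    using B0(3) b B(1) vec.span_mono[of B0 "B - {b}"] by blast
  moreover have "?H \<subseteq> U" by (rule vec.span_minimal) (use B assms in auto)
  ultimately show ?thesis by (intro exI[of _ ?H]) auto
qed

lemma dim_span_insert:
  fixes H :: "('f::field ^ 'n) set"
  assumes "vec.subspace H" "v \<notin> H"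
  shows "vec.dim (vec.span (insert v H)) = vec.dim H + 1"
proof -
  have "vec.span H = H" using assms(1) by simp
  then show ?thesis using assms(2) vec.dim_insert[of v H] by (simp del: vec.span_eq_iff)
qed

lemma dim_Un_Int:
  fixes S U :: "('f::field ^ 'n) set"
  assumes "vec.subspace S" "vec.subspace U"
  shows "vec.dim (vec.span (S \<union> U)) + vec.dim (S \<inter> U) = vec.dim S + vec.dim U"
proof -
  have "vec.span S = S" "vec.span U = U" using assms by simp_all
  then have "vec.span (S \<union> U) = {x + y |x y. x \<in> S \<and> y \<in> U}"
    by (simp only: vec.span_Un)
  then show ?thesis using vec.dim_sums_Int[OF assms] by simp
qed

text \<open>Bases of \<open>S\<close> and of \<open>U\<close> that both extend a basis of
  \<open>S \<inter> U\<close> overlap only in that basis, so the size of their union is the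
  dimension of the sum. A spanning set of that size is independent and extends to the whole
  space.\<close>

lemma adapted_basis:
  fixes S U :: "('f::field ^ 'n) set"
  assumes S: "vec.subspace S" and U: "vec.subspace U"
  shows "\<exists>B B1 B2. vec.independent B \<and> vec.span B = UNIV \<and> B1 \<subseteq> B \<and> B2 \<subseteq> B
    \<and> vec.span B1 = S \<and> vec.span B2 = U \<and> vec.span (B1 \<inter> B2) = S \<inter> U"
proof -
  obtain B0 where B0: "B0 \<subseteq> S \<inter> U" "vec.independent B0" "S \<inter> U \<subseteq> vec.span B0"
      "card B0 = vec.dim (S \<inter> U)"
    by (rule vec.basis_exists)
  obtain B1 where B1: "B0 \<subseteq> B1" "B1 \<subseteq> S" "vec.independent B1" "S \<subseteq> vec.span B1"
    by (rule vec.maximal_independent_subset_extend[of B0 S]) (use B0 in auto)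
  obtain B2 where B2: "B0 \<subseteq> B2" "B2 \<subseteq> U" "vec.independent B2" "U \<subseteq> vec.span B2"
    by (rule vec.maximal_independent_subset_extend[of B0 U]) (use B0 in auto)
  have s: "vec.span B1 = S" "vec.span B2 = U" "vec.span B0 = S \<inter> U"
    using vec.span_subspace[OF B1(2,4) S] vec.span_subspace[OF B2(2,4) U]
      vec.span_subspace[OF B0(1,3) vec.subspace_inter[OF S U]] by auto
  have "B1 \<inter> B2 \<subseteq> B0"
  proof
    fix b assume b: "b \<in> B1 \<inter> B2"
    then have "b \<in> vec.span B0" using B1(2) B2(2) s by blast
    show "b \<in> B0"
    proof (rule ccontr)
      assume "b \<notin> B0"
      then have "b \<in> vec.span (B1 - {b})"
        using \<open>b \<in> vec.span B0\<close> B1(1) vec.span_mono[of B0 "B1 - {b}"] by blast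
      then show False using B1(3) b by (auto simp: vec.dependent_def)
    qed
  qed
  then have i: "B1 \<inter> B2 = B0" using B1(1) B2(1) by blast
  have fin: "finite B1" "finite B2"
    using vec.finiteI_independent B1(3) B2(3) by auto
  have d: "vec.dim S = card B1" "vec.dim U = card B2" "vec.dim (S \<inter> U) = card B0"
    using B0(4) vec.basis_card_eq_dim[OF B1(2,4,3)] vec.basis_card_eq_dim[OF B2(2,4,3)] by simp_all
  have "vec.span (B1 \<union> B2) = vec.span (S \<union> U)"
  proof -
    have "vec.span S = S" "vec.span U = U" using S U by simp_all
    then show ?thesis by (simp only: vec.span_Un s)
  qed
  then have "vec.dim (B1 \<union> B2) = vec.dim (vec.span (S \<union> U))"
    using vec.dim_span[of "B1 \<union> B2"] by simp
  also have "\<dots> = card (B1 \<union> B2)"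
    using dim_Un_Int[OF S U] card_Un_Int[OF fin] d i by simp
  finally have ind: "vec.independent (B1 \<union> B2)"
    using fin by (intro vec.card_le_dim_spanning[of _ "vec.span (B1 \<union> B2)"]) (auto simp: vec.span_superset)
  obtain B where "B1 \<union> B2 \<subseteq> B" "B \<subseteq> UNIV" "vec.independent B" "UNIV \<subseteq> vec.span B"
    by (rule vec.maximal_independent_subset_extend[of "B1 \<union> B2" UNIV]) (use ind in auto)
  then show ?thesis using s i by (intro exI[of _ B] exI[of _ B1] exI[of _ B2]) auto
qed

text \<open>This is the transitivity behind the orbit counts. An adapted basis falls into four
  blocks: in both subspaces, only in the first, only in the second, in neither. The three dimensions
  fix the block sizes, so the blocks can be matched and the matching extended linearly.\<close>

lemma ex_linear_bij_pair:
  fixes S U S' U' :: "('f::field ^ 'n) set"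
  assumes S: "vec.subspace S" and U: "vec.subspace U"
    and S': "vec.subspace S'" and U': "vec.subspace U'"
    and d: "vec.dim S = vec.dim S'" "vec.dim U = vec.dim U'" "vec.dim (S \<inter> U) = vec.dim (S' \<inter> U')"
  shows "\<exists>g. flinear g \<and> bij g \<and> g ` S = S' \<and> g ` U = U'"
proof -
  obtain B B1 B2 where B: "vec.independent B" "vec.span B = UNIV" "B1 \<subseteq> B" "B2 \<subseteq> B"
      "vec.span B1 = S" "vec.span B2 = U" "vec.span (B1 \<inter> B2) = S \<inter> U"
    using adapted_basis[OF S U] by blast
  obtain A A1 A2 where A: "vec.independent A" "vec.span A = UNIV" "A1 \<subseteq> A" "A2 \<subseteq> A"
      "vec.span A1 = S'" "vec.span A2 = U'" "vec.span (A1 \<inter> A2) = S' \<inter> U'"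
    using adapted_basis[OF S' U'] by blast
  have card_basis: "card E = vec.dim (vec.span E)" if "E \<subseteq> F" "vec.independent F" for E F :: "('f ^ 'n) set"
    using that vec.independent_mono[of F E] by (simp add: vec.dim_eq_card_independent)
  have fB: "finite B" and fA: "finite A" using B A vec.finiteI_independent by auto
  have fs: "finite B1" "finite B2" "finite A1" "finite A2"
    using fB fA finite_subset[OF B(3)] finite_subset[OF B(4)] finite_subset[OF A(3)] finite_subset[OF A(4)] by auto
  have "B1 \<inter> B2 \<subseteq> B" "A1 \<inter> A2 \<subseteq> A" using B A by blast+
  then have c: "card B = card A" "card B1 = card A1" "card B2 = card A2" "card (B1 \<inter> B2) = card (A1 \<inter> A2)"
    using card_basis[OF subset_refl B(1)] card_basis[OF subset_refl A(1)]
      card_basis[OF B(3) B(1)] card_basis[OF A(3) A(1)]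
      card_basis[OF B(4) B(1)] card_basis[OF A(4) A(1)]
      card_basis[of "B1 \<inter> B2", OF _ B(1)] card_basis[of "A1 \<inter> A2", OF _ A(1)]
    unfolding A(2,5-7) B(2,5-7) d by simp_all
  have ex: "\<exists>\<phi>. bij_betw \<phi> E F" if "finite E" "finite F" "card E = card F" for E F :: "('f ^ 'n) set"
    using that by (simp add: finite_same_card_bij)
  have "card (B1 - B2) = card (A1 - A2)" "card (B2 - B1) = card (A2 - A1)"
    using c fs card_Diff_subset_Int[of B1 B2] card_Diff_subset_Int[of A1 A2]
      card_Diff_subset_Int[of B2 B1] card_Diff_subset_Int[of A2 A1] by (simp_all add: Int_commute)
  moreover have "card (B - (B1 \<union> B2)) = card (A - (A1 \<union> A2))"
    using c fs A B card_Un_Int[of B1 B2] card_Un_Int[of A1 A2]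
    by (simp add: card_Diff_subset)
  ultimately obtain p0 p1 p2 p3 where p: "bij_betw p0 (B1 \<inter> B2) (A1 \<inter> A2)"
      "bij_betw p1 (B1 - B2) (A1 - A2)" "bij_betw p2 (B2 - B1) (A2 - A1)"
      "bij_betw p3 (B - (B1 \<union> B2)) (A - (A1 \<union> A2))"
    using ex[of "B1 \<inter> B2" "A1 \<inter> A2"] ex[of "B1 - B2" "A1 - A2"] ex[of "B2 - B1" "A2 - A1"]
      ex[of "B - (B1 \<union> B2)" "A - (A1 \<union> A2)"] fs fB fA c(4) by auto
  define p where "p b = (if b \<in> B1 then if b \<in> B2 then p0 b else p1 b else if b \<in> B2 then p2 b else p3 b)" for b
  have im: "p ` (B1 \<inter> B2) = A1 \<inter> A2" "p ` (B1 - B2) = A1 - A2" "p ` (B2 - B1) = A2 - A1"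
      "p ` (B - (B1 \<union> B2)) = A - (A1 \<union> A2)"
    using p unfolding p_def bij_betw_def by (auto simp: image_iff)
  have "p ` B1 = p ` (B1 \<inter> B2) \<union> p ` (B1 - B2)" "p ` B2 = p ` (B1 \<inter> B2) \<union> p ` (B2 - B1)"
    "p ` B = p ` B1 \<union> p ` B2 \<union> p ` (B - (B1 \<union> B2))"
    using B by blast+
  then have "p ` B1 = A1" "p ` B2 = A2" "p ` B = A1 \<union> A2 \<union> (A - (A1 \<union> A2))"
    unfolding im by auto
  then have im': "p ` B1 = A1" "p ` B2 = A2" "p ` B = A"
    using A(3,4) by auto
  obtain g where g: "flinear g" "\<And>b. b \<in> B \<Longrightarrow> g b = p b"
    using vec.linear_independent_extend[OF B(1), of p] by blast
  have gi: "g ` E = p ` E" if "E \<subseteq> B" for E using g that by (intro image_cong) auto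
  have sp: "g ` vec.span E = vec.span (p ` E)" if "E \<subseteq> B" for E
    using vec.linear_span_image[OF g(1), of E] gi[OF that] by simp
  have "surj g" using sp[of B] im' A B by auto
  then have "inj g" using vec.linear_surj_imp_inj g by blast
  then show ?thesis using \<open>surj g\<close> sp[of B1] sp[of B2] im' A B g(1)
    by (intro exI[of _ g]) (auto simp: bij_def)
qed

section \<open>Layers of the Grassmann graph\<close>

text \<open>For \<open>S\<close> a vertex the layers are the distance spheres around \<open>S\<close>, and the layer with
  \<open>j = D - i\<close> has radius \<open>i\<close>. For the kernel or the hull \<open>S\<close> of a Delsarte clique \<open>C\<close>,
  the layer of largest index \<open>min D (dim S)\<close> is \<open>C\<close> itself and the others are the cells \<open>C\<^sub>i\<close>.\<close>

definition layer :: "nat \<Rightarrow> ('f::field ^ 'n) set \<Rightarrow> nat \<Rightarrow> ('f ^ 'n) set set" where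
  "layer D S j = {U \<in> grass_vertices D. vec.dim (U \<inter> S) = j}"

lemma grass_verticesD:
  assumes "U \<in> grass_vertices D"
  shows "vec.subspace U" "vec.dim U = D"
  using assms by (auto simp: grass_vertices_def)

lemma grass_edges_sym: "(U, W) \<in> grass_edges D \<Longrightarrow> (W, U) \<in> grass_edges D"
  by (auto simp: grass_edges_def Int_commute)

lemma subspace_eq_if_dim_le:
  fixes S U :: "('f::field ^ 'n) set"
  assumes "vec.subspace S" "vec.subspace U" "S \<subseteq> U" "vec.dim U \<le> vec.dim S"
  shows "S = U"
  using vec.subspace_dim_equal[OF assms] .

text \<open>\<open>U \<inter> W\<close> is a hyperplane of \<open>U\<close>, so cutting
  \<open>U \<inter> S\<close> down to \<open>W\<close> costs at most one dimension.\<close>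

lemma grass_edges_dim_Int_le:
  fixes U W S :: "('f::field ^ 'n) set"
  assumes "(U, W) \<in> grass_edges D" and S: "vec.subspace S"
  shows "vec.dim (U \<inter> S) \<le> vec.dim (W \<inter> S) + 1"
proof -
  have U: "vec.subspace U" "vec.dim U = D" and W: "vec.subspace W" and d: "vec.dim (U \<inter> W) + 1 = D"
    using assms(1) by (auto simp: grass_edges_def grass_vertices_def)
  have "vec.dim (vec.span ((U \<inter> S) \<union> (U \<inter> W))) \<le> vec.dim U"
    using U(1) by (intro vec.dim_subset vec.span_minimal) auto
  moreover have "vec.dim ((U \<inter> S) \<inter> (U \<inter> W)) \<le> vec.dim (W \<inter> S)"
    by (rule vec.dim_subset) auto
  ultimately show ?thesis
    using dim_Un_Int[OF vec.subspace_inter[OF U(1) S] vec.subspace_inter[OF U(1) W]] d U(2) by linarith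
qed

text \<open>Trade one direction for another: keep a hyperplane of \<open>U\<close> containing
  \<open>U \<inter> S\<close>, available because \<open>U\<close> is not inside \<open>S\<close>,
  and add a vector of \<open>S\<close> outside \<open>U\<close>, available because \<open>S\<close>
  is not inside \<open>U\<close>.\<close>

lemma ex_grass_edge_towards:
  fixes U S :: "('f::field ^ 'n) set"
  assumes U: "U \<in> grass_vertices D" and S: "vec.subspace S"
    and d: "vec.dim (U \<inter> S) < D" "vec.dim (U \<inter> S) < vec.dim S"
  shows "\<exists>W. (U, W) \<in> grass_edges D \<and> vec.dim (W \<inter> S) = vec.dim (U \<inter> S) + 1"
proof -
  note U' = grass_verticesD[OF U]
  have US: "vec.subspace (U \<inter> S)" using U'(1) S by (rule vec.subspace_inter)
  have "U \<inter> S \<noteq> U" using d(1) U'(2) by auto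
  then obtain H where H: "vec.subspace H" "U \<inter> S \<subseteq> H" "H \<subseteq> U" "vec.dim H + 1 = D"
    using ex_hyperplane_containing[OF US U'(1)] U'(2) by auto
  have "U \<inter> S \<noteq> S" using d(2) by auto
  then obtain v where v: "v \<in> S" "v \<notin> U" by blast
  define W where "W = vec.span (insert v H)"
  have "v \<notin> H" using v H by blast
  then have dW: "vec.dim W = D" unfolding W_def using dim_span_insert[OF H(1)] H(4) by simp
  have W: "vec.subspace W" unfolding W_def by simp
  have HW: "H \<subseteq> W" "v \<in> W" unfolding W_def by (auto intro: vec.span_base)
  have "H \<subseteq> U \<inter> W" using H HW by blast
  then have "vec.dim H \<le> vec.dim (U \<inter> W)" by (rule vec.dim_subset)
  moreover have "\<not> D \<le> vec.dim (U \<inter> W)"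
  proof
    assume "D \<le> vec.dim (U \<inter> W)"
    then have "U \<inter> W = W"
      using dW U'(1) W by (intro subspace_eq_if_dim_le vec.subspace_inter) auto
    then show False using HW v by blast
  qed
  ultimately have e: "(U, W) \<in> grass_edges D"
    using U W dW H(4) by (auto simp: grass_edges_def grass_vertices_def)
  have "vec.span (insert v (U \<inter> S)) \<subseteq> W \<inter> S"
    using W S HW H(2) v by (intro vec.span_minimal vec.subspace_inter) auto
  then have "vec.dim (vec.span (insert v (U \<inter> S))) \<le> vec.dim (W \<inter> S)" by (rule vec.dim_subset)
  moreover have "vec.dim (vec.span (insert v (U \<inter> S))) = vec.dim (U \<inter> S) + 1"
    using dim_span_insert[OF US] v by blast
  ultimately have "vec.dim (W \<inter> S) = vec.dim (U \<inter> S) + 1"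
    using grass_edges_dim_Int_le[OF grass_edges_sym[OF e] S] by linarith
  then show ?thesis using e by blast
qed

lemma grass_vertices_dim_Int_le:
  assumes "U \<in> grass_vertices D"
  shows "vec.dim (U \<inter> S) \<le> D"
  using grass_verticesD[OF assms] vec.dim_subset[of "U \<inter> S" U] by simp

text \<open>A step of the graph raises the dimension of the intersection with \<open>W\<close> by at
  most one, and while that dimension is below \<open>D\<close> some step does raise it. The first
  fact bounds path lengths from below, the second builds a path attaining the bound.\<close>

lemma path_dist_grass_edges:
  fixes U W :: "('f::field ^ 'n) set"
  assumes U: "U \<in> grass_vertices D" and W: "W \<in> grass_vertices D"
  shows "path_dist (grass_edges D) U W = D - vec.dim (U \<inter> W)"
proof -
  note W' = grass_verticesD[OF W]
  have reach: "(U, W) \<in> grass_edges D ^^ n" if "U \<in> grass_vertices D" "D = vec.dim (U \<inter> W) + n" for U n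
    using that
  proof (induction n arbitrary: U)
    case 0
    have "U \<inter> W = U" "U \<inter> W = W"
      using 0 grass_verticesD[OF 0(1)] W' by (intro subspace_eq_if_dim_le vec.subspace_inter; simp)+
    then show ?case by auto
  next
    case (Suc n)
    then obtain V where V: "(U, V) \<in> grass_edges D" "vec.dim (V \<inter> W) = vec.dim (U \<inter> W) + 1"
      using ex_grass_edge_towards[OF Suc.prems(1) W'(1)] W'(2) by auto
    then have "(V, W) \<in> grass_edges D ^^ n"
      using Suc by (auto simp: grass_edges_def)
    then show ?case using V(1) by (rule relpow_Suc_I2[rotated])
  qed
  have bound: "D \<le> vec.dim (U \<inter> W) + n" if "(U, W) \<in> grass_edges D ^^ n" for U n
    using that
  proof (induction n arbitrary: U)
    case 0
    then show ?case using W'(2) by simp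
  next
    case (Suc n)
    then obtain V where V: "(U, V) \<in> grass_edges D" "(V, W) \<in> grass_edges D ^^ n"
      by (blast elim: relpow_Suc_E2)
    have "vec.dim (V \<inter> W) \<le> vec.dim (U \<inter> W) + 1"
      using grass_edges_dim_Int_le[OF grass_edges_sym[OF V(1)] W'(1)] .
    then show ?case using Suc.IH[OF V(2)] by simp
  qed
  show ?thesis unfolding path_dist_def
  proof (rule Least_equality)
    show "(U, W) \<in> grass_edges D ^^ (D - vec.dim (U \<inter> W))"
      by (rule reach[OF U]) (use grass_vertices_dim_Int_le[OF U, of W] in simp)
  qed (use bound in fastforce)
qed

section \<open>Symmetry of the layers under the stabiliser of a subspace\<close>

lemma flinear_bij_dim_image:
  fixes g :: "'f::field ^ 'n \<Rightarrow> 'f ^ 'n"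
  assumes "flinear g" "bij g"
  shows "vec.dim (g ` U) = vec.dim U"
  by (rule vec.dim_image_eq[OF assms(1)]) (rule inj_on_subset[OF bij_is_inj[OF assms(2)] subset_UNIV])

lemma flinear_bij_image_layer:
  fixes g :: "'f::field ^ 'n \<Rightarrow> 'f ^ 'n"
  assumes g: "flinear g" "bij g" and "U \<in> layer D S j"
  shows "g ` U \<in> layer D (g ` S) j"
  using assms(3) vec.linear_subspace_image[OF g(1), of U]
  by (simp add: layer_def grass_vertices_def flinear_bij_dim_image[OF g]
      flip: image_Int[OF bij_is_inj[OF g(2)]])

lemma flinear_bij_image_edge:
  fixes g :: "'f::field ^ 'n \<Rightarrow> 'f ^ 'n"
  assumes g: "flinear g" "bij g" and "(U, W) \<in> grass_edges D"
  shows "(g ` U, g ` W) \<in> grass_edges D"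
  using assms(3) vec.linear_subspace_image[OF g(1), of U] vec.linear_subspace_image[OF g(1), of W]
  by (simp add: grass_edges_def grass_vertices_def flinear_bij_dim_image[OF g]
      flip: image_Int[OF bij_is_inj[OF g(2)]])

text \<open>A linear bijection that fixes \<open>S\<close> and carries \<open>U\<close> to
  \<open>U'\<close> injects one neighbour set into the other. An inequality is enough, since
  \<open>U\<close> and \<open>U'\<close> can be exchanged.\<close>

lemma card_layer_neighbours_le:
  fixes U U' S :: "('f::{field,finite} ^ 'n) set"
  assumes S: "vec.subspace S" and U: "U \<in> layer D S j" and U': "U' \<in> layer D S j"
  shows "card {W \<in> layer D S i. (W, U) \<in> grass_edges D} \<le> card {W \<in> layer D S i. (W, U') \<in> grass_edges D}"
proof -
  obtain g where g: "flinear g" "bij g" "g ` S = S" "g ` U = U'"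
    using ex_linear_bij_pair[OF S _ S, of U U'] U U' by (auto simp: layer_def grass_vertices_def Int_commute)
  have "inj_on ((`) g) {W \<in> layer D S i. (W, U) \<in> grass_edges D}"
    using g(2) by (meson bij_is_inj inj_image_eq_iff inj_onI)
  moreover have "(`) g ` {W \<in> layer D S i. (W, U) \<in> grass_edges D} \<subseteq> {W \<in> layer D S i. (W, U') \<in> grass_edges D}"
    using flinear_bij_image_layer[OF g(1,2), of _ D S i] flinear_bij_image_edge[OF g(1,2), of _ U D] g(3,4) by auto
  ultimately show ?thesis by (intro card_inj_on_le) auto
qed

lemma card_layer_neighbours_eq:
  fixes U U' S :: "('f::{field,finite} ^ 'n) set"
  assumes "vec.subspace S" "U \<in> layer D S j" "U' \<in> layer D S j"
  shows "card {W \<in> layer D S i. (W, U) \<in> grass_edges D} = card {W \<in> layer D S i. (W, U') \<in> grass_edges D}"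
  using assms by (intro antisym card_layer_neighbours_le)

text \<open>Transitivity is applied to \<open>S\<close> together with the line through the vector;
  their intersection has dimension 1 or 0 according to whether the vector lies in
  \<open>S\<close>.\<close>

lemma card_layer_through_le:
  fixes v v' :: "'f::{field,finite} ^ 'n"
  assumes S: "vec.subspace S" and v: "v \<noteq> 0" "v' \<noteq> 0" "v \<in> S \<longleftrightarrow> v' \<in> S"
  shows "card {U \<in> layer D S j. v \<in> U} \<le> card {U \<in> layer D S j. v' \<in> U}"
proof -
  have dim_line: "vec.dim (S \<inter> vec.span {w}) = of_bool (w \<in> S)" if "w \<noteq> 0" for w
  proof (cases "w \<in> S")
    case True
    then have "S \<inter> vec.span {w} = vec.span {w}" using vec.span_minimal[of "{w}" S] S by auto
    then show ?thesis using that True by simp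
  next
    case False
    have "S \<inter> vec.span {w} \<subseteq> {0}"
    proof
      fix u assume "u \<in> S \<inter> vec.span {w}"
      then obtain c where c: "u = c *s w" "u \<in> S" by (auto simp: vec.span_singleton)
      have "c = 0"
      proof (rule ccontr)
        assume "c \<noteq> 0"
        then have "w = inverse c *s u" using c by (simp add: vec.scale_scale)
        then show False using False vec.subspace_scale[OF S c(2)] by simp
      qed
      then show "u \<in> {0}" using c by simp
    qed
    then have "vec.dim (S \<inter> vec.span {w}) \<le> vec.dim ({} :: ('f ^ 'n) set)"
      by (intro vec.dim_mono) simp
    then show ?thesis using False by simp
  qed
  obtain g where g: "flinear g" "bij g" "g ` S = S" "g ` vec.span {v} = vec.span {v'}"
    using ex_linear_bij_pair[OF S _ S, of "vec.span {v}" "vec.span {v'}"] dim_line v by auto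
  \<comment> \<open>\<open>g\<close> maps line to line but need not send \<open>v\<close> to
    \<open>v'\<close>; a subspace containing the image line contains \<open>v'\<close>, which is
    enough.\<close>
  have "v' \<in> g ` U" if "U \<in> layer D S j" "v \<in> U" for U
  proof -
    have "vec.span {v} \<subseteq> U"
      using that by (intro vec.span_minimal) (auto simp: layer_def grass_vertices_def)
    then have "vec.span {v'} \<subseteq> g ` U" using g(4) by blast
    then show ?thesis using vec.span_base[of v' "{v'}"] by blast
  qed
  then have "(`) g ` {U \<in> layer D S j. v \<in> U} \<subseteq> {U \<in> layer D S j. v' \<in> U}"
    using flinear_bij_image_layer[OF g(1,2), of _ D S j] g(3) by auto
  moreover have "inj_on ((`) g) {U \<in> layer D S j. v \<in> U}"
    using g(2) by (meson bij_is_inj inj_image_eq_iff inj_onI)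
  ultimately show ?thesis by (intro card_inj_on_le) auto
qed

lemma card_layer_through_eq:
  fixes v v' :: "'f::{field,finite} ^ 'n"
  assumes "vec.subspace S" "v \<noteq> 0" "v' \<noteq> 0" "v \<in> S \<longleftrightarrow> v' \<in> S"
  shows "card {U \<in> layer D S j. v \<in> U} = card {U \<in> layer D S j. v' \<in> U}"
  using assms by (intro antisym card_layer_through_le) auto

section \<open>Double counting of vectors and subspaces\<close>

lemma sum_card_Int_swap:
  assumes "finite P" "finite Z"
  shows "(\<Sum>U\<in>P. card (U \<inter> Z)) = (\<Sum>v\<in>Z. card {U \<in> P. v \<in> U})"
proof -
  have "(\<Sum>U\<in>P. card (U \<inter> Z)) = (\<Sum>U\<in>P. \<Sum>v\<in>Z. of_bool (v \<in> U))"
    using assms by (intro sum.cong) (auto simp: sum.If_cases of_bool_def Int_def intro!: arg_cong[where f = card])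
  also have "\<dots> = (\<Sum>v\<in>Z. \<Sum>U\<in>P. of_bool (v \<in> U))" by (rule sum.swap)
  also have "\<dots> = (\<Sum>v\<in>Z. card {U \<in> P. v \<in> U})"
    using assms by (intro sum.cong) (auto simp: sum.If_cases of_bool_def Int_def intro!: arg_cong[where f = card])
  finally show ?thesis .
qed

text \<open>Either choice of \<open>R\<close> consists of vectors that the stabiliser of
  \<open>S\<close> cannot tell apart, so each lies in the same number of members of the layer, and
  both incidence sums are that number times a cardinality.\<close>

lemma layer_double_count:
  fixes S :: "('f::{field,finite} ^ 'n) set"
  assumes S: "vec.subspace S" and R: "R = S - {0} \<or> R = - S" and Z: "Z \<subseteq> R"
  shows "card R * (\<Sum>U\<in>layer D S j. card (U \<inter> Z)) = card Z * (\<Sum>U\<in>layer D S j. card (U \<inter> R))"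
proof -
  have eq: "card {U \<in> layer D S j. v \<in> U} = card {U \<in> layer D S j. v' \<in> U}" if "v \<in> R" "v' \<in> R" for v v'
    using that R vec.subspace_0[OF S] by (intro card_layer_through_eq[OF S]) auto
  \<comment> \<open>For empty \<open>R\<close> the choice is arbitrary, but the value only matters
    at vectors of \<open>R\<close>.\<close>
  define m where "m = card {U \<in> layer D S j. (SOME v. v \<in> R) \<in> U}"
  have m: "card {U \<in> layer D S j. v \<in> U} = m" if "v \<in> R" for v
    unfolding m_def by (rule eq[OF that someI[of "\<lambda>v. v \<in> R", OF that]])
  have "(\<Sum>U\<in>layer D S j. card (U \<inter> Y)) = card Y * m" if "Y \<subseteq> R" for Y
  proof -
    have "(\<Sum>U\<in>layer D S j. card (U \<inter> Y)) = (\<Sum>v\<in>Y. card {U \<in> layer D S j. v \<in> U})"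
      by (rule sum_card_Int_swap) auto
    also have "\<dots> = (\<Sum>v\<in>Y. m)" using m that by (intro sum.cong) auto
    finally show ?thesis by simp
  qed
  then show ?thesis using Z by simp
qed

section \<open>Modules over the Bose--Mesner algebra\<close>

lemma char_vec_empty [simp]: "char_vec {} = 0"
  by (simp add: char_vec_def vec_eq_iff)

lemma adj_matrix_mult_char_vec_nth:
  fixes Y :: "'v::finite set"
  shows "(adj_matrix E *v char_vec Y) $ y = of_nat (card {z \<in> Y. (y, z) \<in> E})"
proof -
  have "{z \<in> Y. (y, z) \<in> E} = {z. (y, z) \<in> E} \<inter> Y" by blast
  then show ?thesis by (simp add: adj_matrix_def char_vec_def matrix_vector_mult_def)
qed

lemma id_matrix_mult_vec_nth:
  fixes w :: "complex ^ 'v::finite"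
  shows "(id_matrix X *v w) $ y = of_bool (y \<in> X) * w $ y"
proof -
  have "(id_matrix X *v w) $ y = (\<Sum>z\<in>UNIV. if z = y then of_bool (y \<in> X) * w $ y else 0)"
    unfolding id_matrix_def matrix_vector_mult_def by (auto intro!: sum.cong)
  then show ?thesis by simp
qed

lemma scaled_matrix_mult_vec:
  fixes A :: "complex ^ 'v ^ 'v::finite"
  shows "(\<chi> y z. c * A $ y $ z) *v w = c *s (A *v w)"
  by (simp add: vec_eq_iff matrix_vector_mult_def sum_distrib_left mult.assoc)

lemma id_matrix_mult_char_vec: "Y \<subseteq> X \<Longrightarrow> id_matrix X *v char_vec Y = char_vec Y"
  by (auto simp: vec_eq_iff id_matrix_mult_vec_nth char_vec_def)

lemma subspace_module_generated:
  "vec.subspace (module_generated (bose_mesner X E) v)"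
proof (rule vec.subspaceI)
  \<comment> \<open>No generating rule yields the zero matrix directly; it is the zero multiple of
    the identity.\<close>
  have "(\<chi> y z. 0 * id_matrix X $ y $ z) *v v = 0" 
    unfolding scaled_matrix_mult_vec by simp
  then show "0 \<in> module_generated (bose_mesner X E) v"
    unfolding module_generated_def by (metis bose_mesner.one bose_mesner.scale imageI)
next
  fix a b assume "a \<in> module_generated (bose_mesner X E) v" "b \<in> module_generated (bose_mesner X E) v"
  then show "a + b \<in> module_generated (bose_mesner X E) v"
    unfolding module_generated_def
    by (auto simp flip: matrix_vector_mult_add_rdistrib intro: bose_mesner.add)
next
  fix c a assume "a \<in> module_generated (bose_mesner X E) v"
  then show "c *s a \<in> module_generated (bose_mesner X E) v"
    unfolding module_generated_def
    by (auto simp flip: scaled_matrix_mult_vec intro: bose_mesner.scale)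
qed

lemma module_generated_adj:
  assumes "a \<in> module_generated (bose_mesner X E) v"
  shows "adj_matrix E *v a \<in> module_generated (bose_mesner X E) v"
  using assms unfolding module_generated_def
  by (auto simp: matrix_vector_mul_assoc intro!: imageI bose_mesner.mult[OF bose_mesner.adj])

lemma module_generated_self:
  assumes "Y \<subseteq> X"
  shows "char_vec Y \<in> module_generated (bose_mesner X E) (char_vec Y)"
  unfolding module_generated_def using id_matrix_mult_char_vec[OF assms] bose_mesner.one by (metis imageI)

text \<open>Invariance under the generators passes to the whole algebra by induction. The identity
  counts as a generator to be checked because \<open>id_matrix X\<close> truncates to
  \<open>X\<close> instead of fixing every vector.\<close>

lemma module_generated_subset:
  assumes V: "vec.subspace V" "v \<in> V"
    and "\<And>w. w \<in> V \<Longrightarrow> id_matrix X *v w \<in> V" and "\<And>w. w \<in> V \<Longrightarrow> adj_matrix E *v w \<in> V"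
  shows "module_generated (bose_mesner X E) v \<subseteq> V"
proof -
  have "A *v w \<in> V" if "A \<in> bose_mesner X E" "w \<in> V" for A w
    using that
  proof (induction A arbitrary: w)
    case (add A B)
    then show ?case by (simp add: matrix_vector_mult_add_rdistrib vec.subspace_add[OF V(1)])
  next
    case (scale A c)
    then show ?case by (simp add: scaled_matrix_mult_vec vec.subspace_scale[OF V(1)])
  next
    case (mult A B)
    then show ?case by (simp flip: matrix_vector_mul_assoc)
  qed (use assms in auto)
  then show ?thesis using V(2) by (auto simp: module_generated_def)
qed

definition layer_span :: "nat \<Rightarrow> ('f::{field,finite} ^ 'n) set \<Rightarrow> (complex ^ ('f ^ 'n) set) set" where
  "layer_span D S = vec.span (range (\<lambda>j. char_vec (layer D S j)))"

lemma matrix_mult_layer_span: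
  assumes "\<And>j. A *v char_vec (layer D S j) \<in> layer_span D S" and "w \<in> layer_span D S"
  shows "A *v w \<in> layer_span D S"
proof -
  have "layer_span D S \<subseteq> {w. A *v w \<in> layer_span D S}"
    unfolding layer_span_def
  proof (rule vec.span_minimal)
    show "vec.subspace {w. A *v w \<in> vec.span (range (\<lambda>j. char_vec (layer D S j)))}"
      by (rule vec.subspaceI)
        (auto simp: matrix_vector_right_distrib vector_scalar_commute vec.span_zero intro: vec.span_add vec.span_scale)
  qed (use assms(1) in \<open>auto simp: layer_span_def\<close>)
  then show ?thesis using assms(2) by blast
qed

lemma layer_subset: "layer D S j \<subseteq> grass_vertices D"
  by (auto simp: layer_def)

lemma layer_empty:
  assumes "j > min D (vec.dim S)"
  shows "layer D S j = {}"
proof -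
  have "vec.dim (U \<inter> S) \<le> min D (vec.dim S)" if "U \<in> grass_vertices D" for U
    using grass_vertices_dim_Int_le[OF that] vec.dim_subset[of "U \<inter> S" S] by simp
  then show ?thesis using assms unfolding layer_def by fastforce
qed

text \<open>The numbers \<open>n j\<close> exist because the stabiliser of \<open>S\<close> in the general linear group acts
  transitively on each layer.\<close>

lemma adj_matrix_mult_layer:
  fixes S :: "('f::{field,finite} ^ 'n) set"
  assumes S: "vec.subspace S"
  shows "\<exists>n. (\<forall>j. \<forall>U\<in>layer D S j. n j = card {W \<in> layer D S i. (W, U) \<in> grass_edges D}) \<and>
    adj_matrix (grass_edges D) *v char_vec (layer D S i)
      = (\<Sum>j\<le>D. of_nat (n j) *s char_vec (layer D S j))"
proof -
  \<comment> \<open>On an empty layer this value is arbitrary, but there it multiplies the zero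
    vector.\<close>
  define n where "n j = card {W \<in> layer D S i. (W, SOME U. U \<in> layer D S j) \<in> grass_edges D}" for j
  have n: "n j = card {W \<in> layer D S i. (W, U) \<in> grass_edges D}" if "U \<in> layer D S j" for j U
    unfolding n_def by (rule card_layer_neighbours_eq[OF S someI[of "\<lambda>U. U \<in> layer D S j", OF that] that])
  have "(adj_matrix (grass_edges D) *v char_vec (layer D S i)) $ U
      = (\<Sum>j\<le>D. of_nat (n j) *s char_vec (layer D S j)) $ U" for U
  proof -
    have sym: "{W \<in> layer D S i. (U, W) \<in> grass_edges D} = {W \<in> layer D S i. (W, U) \<in> grass_edges D}"
      using grass_edges_sym by blast
    have r: "(\<Sum>j\<le>D. of_nat (n j) *s char_vec (layer D S j)) $ U
        = (\<Sum>j\<le>D. of_nat (n j) * of_bool (U \<in> layer D S j))"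
      by (simp add: char_vec_def)
    show ?thesis
    proof (cases "U \<in> grass_vertices D")
      case True
      define l where "l = vec.dim (U \<inter> S)"
      have l: "l \<le> D" "\<And>j. U \<in> layer D S j \<longleftrightarrow> j = l"
        using True grass_vertices_dim_Int_le[OF True] by (auto simp: layer_def l_def)
      have "(\<Sum>j\<le>D. of_nat (n j) * of_bool (U \<in> layer D S j)) = (\<Sum>j\<le>D. if j = l then of_nat (n l) else 0 :: complex)"
        using l by (intro sum.cong) auto
      also have "\<dots> = of_nat (n l)" using l by simp
      finally show ?thesis using n[of U l] l r sym by (simp add: adj_matrix_mult_char_vec_nth)
    next
      case False
      then have "{W \<in> layer D S i. (U, W) \<in> grass_edges D} = {}" "\<And>j. U \<notin> layer D S j"
        by (auto simp: grass_edges_def layer_def)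
      then show ?thesis unfolding r by (simp add: adj_matrix_mult_char_vec_nth)
    qed
  qed
  then show ?thesis using n by (intro exI[of _ n]) (simp add: vec_eq_iff)
qed

text \<open>\<open>m\<close> is the top index, so the generating layer is \<open>{x}\<close> when
  \<open>S\<close> is \<open>x\<close>, and \<open>C\<close> when \<open>S\<close> is the kernel or
  hull of the clique. Regularity of adjacency between layers makes the span invariant; conversely,
  the layers are recovered one by one from the top down.\<close>

lemma module_generated_layer:
  fixes S :: "('f::{field,finite} ^ 'n) set"
  assumes S: "vec.subspace S" and m: "m = min D (vec.dim S)"
  shows "module_generated (grass_bose_mesner D) (char_vec (layer D S m)) = layer_span D S"
proof
  let ?c = "\<lambda>j. char_vec (layer D S j)"
  let ?M = "module_generated (grass_bose_mesner D) (?c m)"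
  have c: "?c j \<in> layer_span D S" for j unfolding layer_span_def by (intro vec.span_base) simp
  have sub: "vec.subspace (layer_span D S)" unfolding layer_span_def by simp
  show "?M \<subseteq> layer_span D S"
    unfolding grass_bose_mesner_def
  proof (rule module_generated_subset[OF sub c])
    show "id_matrix (grass_vertices D) *v w \<in> layer_span D S" if "w \<in> layer_span D S" for w
      by (rule matrix_mult_layer_span[OF _ that]) (simp add: id_matrix_mult_char_vec[OF layer_subset] c)
    show "adj_matrix (grass_edges D) *v w \<in> layer_span D S" if "w \<in> layer_span D S" for w
    proof (rule matrix_mult_layer_span[OF _ that])
      fix i
      show "adj_matrix (grass_edges D) *v ?c i \<in> layer_span D S"
        using adj_matrix_mult_layer[OF S, of D i] c sub
        by (auto intro!: vec.subspace_sum vec.subspace_scale)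
    qed
  qed
  have subM: "vec.subspace ?M" unfolding grass_bose_mesner_def by (rule subspace_module_generated)
  text \<open>Descending induction: \<open>A\<close> maps layer \<open>l + 1\<close> to a combination of layers \<open>l, l + 1, l + 2\<close> whose
    coefficient at \<open>l\<close> is nonzero.\<close>
  have "?c l \<in> ?M" if "l \<ge> m - k" for k l
    using that
  proof (induction k arbitrary: l)
    case 0
    show ?case
    proof (cases "l = m")
      case True
      then show ?thesis unfolding grass_bose_mesner_def by (simp add: module_generated_self layer_subset)
    next
      case False
      then have "layer D S l = {}" using 0 m by (intro layer_empty) simp
      then show ?thesis using vec.subspace_0[OF subM] by simp
    qed
  next
    case (Suc k)
    show ?case
    proof (cases "l \<ge> m - k \<or> layer D S l = {}")
      case True
      then show ?thesis using Suc.IH vec.subspace_0[OF subM] by auto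
    next
      case False
      then have l: "l < m" "Suc l = m - k" using Suc.prems by auto
      obtain U where U: "U \<in> layer D S l" using False by blast
      obtain n where n: "\<And>j U. U \<in> layer D S j \<Longrightarrow> n j = card {W \<in> layer D S (Suc l). (W, U) \<in> grass_edges D}"
        and adj: "adj_matrix (grass_edges D) *v ?c (Suc l) = (\<Sum>j\<le>D. of_nat (n j) *s ?c j)"
        using adj_matrix_mult_layer[OF S, of D "Suc l"] by blast
      \<comment> \<open>\<open>l\<close> is smaller than both \<open>D\<close> and
        \<open>vec.dim S\<close>, so \<open>U\<close> has a neighbour one layer up; this makes the
        coefficient at \<open>l\<close> invertible.\<close>
      obtain W where W: "(U, W) \<in> grass_edges D" "vec.dim (W \<inter> S) = Suc l"
        using ex_grass_edge_towards[of U D S] U S l(1) m by (auto simp: layer_def)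
      then have "W \<in> {W \<in> layer D S (Suc l). (W, U) \<in> grass_edges D}"
        using grass_edges_sym by (auto simp: layer_def grass_edges_def Int_commute)
      then have nz: "n l \<noteq> 0" using n[OF U] by (auto simp: card_eq_0_iff)
      have low: "of_nat (n j) *s ?c j = 0" if "j < l" for j
      proof (cases "layer D S j = {}")
        case False
        then obtain U' where U': "U' \<in> layer D S j" by blast
        have "{W \<in> layer D S (Suc l). (W, U') \<in> grass_edges D} = {}"
          using grass_edges_dim_Int_le[OF _ S] U' that by (fastforce simp: layer_def)
        then show ?thesis using n[OF U'] by simp
      qed simp
      have "l \<le> D" using l m by simp
      then have "{..D} = {..<l} \<union> insert l {Suc l..D}" by auto
      then have "adj_matrix (grass_edges D) *v ?c (Suc l)
          = of_nat (n l) *s ?c l + (\<Sum>j\<in>{Suc l..D}. of_nat (n j) *s ?c j)"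
        unfolding adj using sum.neutral[of "{..<l}" "\<lambda>j. of_nat (n j) *s ?c j"] low
        by (subst \<open>{..D} = _\<close>, subst sum.union_disjoint)
          (auto simp del: vec.scale_eq_0_iff vector_mul_eq_0)
      moreover have "adj_matrix (grass_edges D) *v ?c (Suc l) \<in> ?M"
        using Suc.IH[of "Suc l"] l unfolding grass_bose_mesner_def by (intro module_generated_adj) simp
      moreover have "(\<Sum>j\<in>{Suc l..D}. of_nat (n j) *s ?c j) \<in> ?M"
        using Suc.IH l by (intro vec.subspace_sum[OF subM] vec.subspace_scale[OF subM]) simp
      ultimately have "of_nat (n l) *s ?c l + (\<Sum>j\<in>{Suc l..D}. of_nat (n j) *s ?c j)
          - (\<Sum>j\<in>{Suc l..D}. of_nat (n j) *s ?c j) \<in> ?M"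
        by (intro vec.subspace_diff[OF subM]) simp_all
      then have "of_nat (n l) *s ?c l \<in> ?M" by (simp only: add_diff_cancel_right')
      then have "inverse (of_nat (n l)) *s (of_nat (n l) *s ?c l) \<in> ?M"
        by (rule vec.subspace_scale[OF subM])
      then show ?thesis using nz by (simp add: vec.scale_scale)
    qed
  qed
  from this[of m] have "?c l \<in> ?M" for l by simp
  then show "layer_span D S \<subseteq> ?M"
    unfolding layer_span_def by (intro vec.span_minimal subM) auto
qed

section \<open>Orthogonal projections\<close>

lemma hermitian_inner_add_left: "hermitian_inner (u + v) w = hermitian_inner u w + hermitian_inner v w"
  by (simp add: hermitian_inner_def distrib_right sum.distrib)

lemma hermitian_inner_scale_left: "hermitian_inner (c *s u) w = c * hermitian_inner u w"
  by (simp add: hermitian_inner_def sum_distrib_left mult.assoc)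

lemma hermitian_inner_diff_left: "hermitian_inner (u - v) w = hermitian_inner u w - hermitian_inner v w"
  by (simp add: hermitian_inner_def left_diff_distrib sum_subtractf)

lemma hermitian_inner_add_right: "hermitian_inner u (v + w) = hermitian_inner u v + hermitian_inner u w"
  by (simp add: hermitian_inner_def distrib_left sum.distrib)

lemma hermitian_inner_scale_right: "hermitian_inner u (c *s w) = cnj c * hermitian_inner u w"
  by (simp add: hermitian_inner_def sum_distrib_left mult_ac)

lemma hermitian_inner_zero [simp]: "hermitian_inner 0 w = 0" "hermitian_inner w 0 = 0"
  by (simp_all add: hermitian_inner_def)

lemma hermitian_inner_self_eq_0:
  assumes "hermitian_inner u u = 0"
  shows "u = 0"
proof -
  have "complex_of_real (\<Sum>y\<in>UNIV. (cmod (u $ y))\<^sup>2) = 0"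
    using assms by (simp add: hermitian_inner_def complex_norm_square del: of_real_power)
  then have "(\<Sum>y\<in>UNIV. (cmod (u $ y))\<^sup>2) = 0" by (simp only: of_real_eq_0_iff)
  then show ?thesis by (simp add: sum_nonneg_eq_0_iff vec_eq_iff)
qed

lemma hermitian_inner_char_vec: "hermitian_inner (char_vec Y) (char_vec Z) = of_nat (card (Y \<inter> Z))"
proof -
  have "hermitian_inner (char_vec Y) (char_vec Z) = (\<Sum>y\<in>UNIV. of_bool (y \<in> Y \<inter> Z))"
    unfolding hermitian_inner_def char_vec_def by (intro sum.cong) auto
  moreover have "{y. y \<in> Y \<inter> Z} = Y \<inter> Z" by blast
  ultimately show ?thesis by simp
qed

text \<open>Two candidates differ by a vector of \<open>V\<close> that is orthogonal to
  \<open>V\<close>, hence to itself, so the definite description is determined.\<close>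

lemma orth_proj_eqI:
  assumes "vec.subspace V" "p \<in> V" "\<And>s. s \<in> V \<Longrightarrow> hermitian_inner (w - p) s = 0"
  shows "orth_proj V w = p"
  unfolding orth_proj_def
proof (rule the_equality)
  fix p' assume p': "p' \<in> V \<and> (\<forall>s\<in>V. hermitian_inner (w - p') s = 0)"
  then have "p - p' \<in> V" using assms by (simp add: vec.subspace_diff)
  then have "hermitian_inner ((w - p') - (w - p)) (p - p') = 0"
    using p' assms(3) by (subst hermitian_inner_diff_left) simp
  then show "p' = p" using hermitian_inner_self_eq_0[of "p - p'"] by simp
qed (use assms in auto)

text \<open>Being the orthogonal projection of \<open>w\<close> is a linear condition on \<open>w\<close>, so it suffices to
  check generators.\<close>

lemma orth_proj_eq_on_span:
  assumes V: "vec.subspace V" and T: "linear_endo_on (vec.span G) T"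
    and gen: "\<And>u. u \<in> G \<Longrightarrow> a *s (T u + b *s u) \<in> V"
      "\<And>u s. u \<in> G \<Longrightarrow> s \<in> V \<Longrightarrow> hermitian_inner (u - a *s (T u + b *s u)) s = 0"
    and w: "w \<in> vec.span G"
  shows "orth_proj V w = a *s (T w + b *s w)"
proof -
  define f where "f u = a *s (T u + b *s u)" for u
  let ?P = "{u \<in> vec.span G. f u \<in> V \<and> (\<forall>s\<in>V. hermitian_inner (u - f u) s = 0)}"
  have f_add: "f (u + v) = f u + f v" if "u \<in> vec.span G" "v \<in> vec.span G" for u v
    using T that by (simp add: linear_endo_on_def f_def vec.scale_right_distrib)
  have f_scale: "f (c *s u) = c *s f u" if "u \<in> vec.span G" for c u
    using T that by (simp add: linear_endo_on_def f_def vec.scale_right_distrib mult.commute mult.left_commute)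
  have f_0: "f 0 = 0" using f_scale[of 0 0] vec.span_zero[of G] by simp
  have "vec.subspace ?P"
  proof (rule vec.subspaceI)
    show "0 \<in> ?P" using f_0 vec.subspace_0[OF V] vec.span_zero[of G] by simp
  next
    fix u v assume u: "u \<in> ?P" and v: "v \<in> ?P"
    have "u + v - f (u + v) = (u - f u) + (v - f v)" using f_add u v by simp
    then have "hermitian_inner (u + v - f (u + v)) s = 0" if "s \<in> V" for s
      using u v that by (simp only: hermitian_inner_add_left) simp
    moreover have "f (u + v) \<in> V" using f_add u v by (simp add: vec.subspace_add[OF V])
    ultimately show "u + v \<in> ?P" using u v by (simp add: vec.span_add)
  next
    fix c u assume u: "u \<in> ?P"
    have "c *s u - f (c *s u) = c *s (u - f u)" using f_scale u by (simp add: vec.scale_right_diff_distrib)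
    then have "hermitian_inner (c *s u - f (c *s u)) s = 0" if "s \<in> V" for s
      using u that by (simp only: hermitian_inner_scale_left) simp
    moreover have "f (c *s u) \<in> V" using f_scale u by (simp add: vec.subspace_scale[OF V])
    ultimately show "c *s u \<in> ?P" using u by (simp add: vec.span_scale)
  qed
  moreover have "G \<subseteq> ?P" using gen by (auto simp: f_def intro: vec.span_base)
  ultimately have "w \<in> ?P" using w vec.span_minimal[of G ?P] by blast
  then show ?thesis using orth_proj_eqI[OF V, of "f w" w] by (auto simp: f_def)
qed

text \<open>Distinct layers are disjoint, so their characteristic vectors are orthogonal and a set
  inside one layer projects to a multiple of that layer alone, by its proportion. The product form
  of the hypothesis on \<open>c\<close> also covers empty layers.\<close>

lemma layer_projection:
  fixes S :: "('f::{field,finite} ^ 'n) set"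
  assumes Y: "Y \<subseteq> layer D S j" and c: "c * of_nat (card (layer D S j)) = of_nat (card Y)"
    and p: "p = c *s char_vec (layer D S j)"
  shows "p \<in> layer_span D S" "\<And>s. s \<in> layer_span D S \<Longrightarrow> hermitian_inner (char_vec Y - p) s = 0"
proof -
  show "p \<in> layer_span D S"
    unfolding p layer_span_def by (intro vec.span_scale vec.span_base) simp
  fix s assume s: "s \<in> layer_span D S"
  have "layer_span D S \<subseteq> {s. hermitian_inner (char_vec Y - p) s = 0}"
    unfolding layer_span_def
  proof (rule vec.span_minimal)
    show "vec.subspace {s. hermitian_inner (char_vec Y - p) s = 0}"
      by (rule vec.subspaceI) (auto simp: hermitian_inner_add_right hermitian_inner_scale_right)
    have "hermitian_inner (char_vec Y - p) (char_vec (layer D S l)) = 0" for l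
    proof (cases "l = j")
      case True
      then show ?thesis using Y c
        by (simp add: p hermitian_inner_diff_left hermitian_inner_scale_left hermitian_inner_char_vec Int_absorb2)
    next
      case False
      then have "layer D S j \<inter> layer D S l = {}" by (auto simp: layer_def)
      moreover from this have "Y \<inter> layer D S l = {}" using Y by blast
      ultimately show ?thesis
        by (simp add: p hermitian_inner_diff_left hermitian_inner_scale_left hermitian_inner_char_vec)
    qed
    then show "range (\<lambda>j. char_vec (layer D S j)) \<subseteq> {s. hermitian_inner (char_vec Y - p) s = 0}"
      by auto
  qed
  then show "hermitian_inner (char_vec Y - p) s = 0" using s by blast
qed

section \<open>Cell sizes\<close>

text \<open>This is what makes the layers of \<open>A\<close> and \<open>B\<close>
  interleave.\<close>

lemma dim_Int_hyperplane:
  fixes A B U :: "('f::field ^ 'n) set"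
  assumes A: "vec.subspace A" and B: "vec.subspace B" and AB: "A \<subseteq> B" "vec.dim B = vec.dim A + 1"
    and U: "vec.subspace U"
  shows "vec.dim (U \<inter> A) \<le> vec.dim (U \<inter> B)" "vec.dim (U \<inter> B) \<le> vec.dim (U \<inter> A) + 1"
proof -
  show "vec.dim (U \<inter> A) \<le> vec.dim (U \<inter> B)" using AB(1) by (intro vec.dim_subset) blast
  have "vec.dim (vec.span ((U \<inter> B) \<union> A)) \<le> vec.dim B"
    using B AB by (intro vec.dim_subset vec.span_minimal) auto
  moreover have "(U \<inter> B) \<inter> A = U \<inter> A" using AB(1) by blast
  ultimately show "vec.dim (U \<inter> B) \<le> vec.dim (U \<inter> A) + 1"
    using dim_Un_Int[OF vec.subspace_inter[OF U B] A] AB(2) by simp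
qed

lemma card_Diff_subspace:
  fixes A B :: "('f::{field,finite} ^ 'n) set"
  assumes "vec.subspace A" "vec.subspace B" "A \<subseteq> B"
  shows "real (card (B - A)) = real CARD('f) ^ vec.dim B - real CARD('f) ^ vec.dim A"
proof -
  have "card A \<le> card B" using assms(3) by (intro card_mono) auto
  then show ?thesis
    using assms by (simp add: card_Diff_subset of_nat_diff card_subspace)
qed

lemma CARD_field_ge_2: "CARD('f::{field,finite}) \<ge> 2"
proof -
  have "card {0, 1 :: 'f} \<le> CARD('f)" by (intro card_mono) auto
  then show ?thesis by simp
qed

lemma sum_card_Int_two_values:
  assumes "finite L" "P \<subseteq> L" "\<And>U. U \<in> P \<Longrightarrow> f U = c" "\<And>U. U \<in> L - P \<Longrightarrow> f U = 0"
  shows "(\<Sum>U\<in>L. f U) = real (card P) * c"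
proof -
  have "(\<Sum>U\<in>L. f U) = (\<Sum>U\<in>P. f U)"
    using assms by (intro sum.mono_neutral_right) auto
  then show ?thesis using assms(3) by simp
qed

text \<open>Count the pairs \<open>v \<in> U\<close> with \<open>U\<close> in the layer: restricting \<open>v\<close> to \<open>B - A\<close> detects the
  members \<open>U\<close> with \<open>U \<inter> B \<noteq> U \<inter> A\<close>, while by transitivity every nonzero \<open>v \<in> B\<close> lies in equally many \<open>U\<close>.\<close>

lemma card_layer_hyperplane_inner:
  fixes A B :: "('f::{field,finite} ^ 'n) set"
  assumes A: "vec.subspace A" and B: "vec.subspace B" and AB: "A \<subseteq> B" "vec.dim B = vec.dim A + 1"
    and b: "Suc b \<le> vec.dim B" and q: "q = real CARD('f)"
  shows "real (card (layer D A b \<inter> layer D B (Suc b))) * (q ^ vec.dim B - 1)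
    = q ^ (vec.dim B - Suc b) * (q ^ Suc b - 1) * real (card (layer D B (Suc b)))"
proof -
  let ?L = "layer D B (Suc b)" and ?P = "layer D A b \<inter> layer D B (Suc b)"
  have q1: "q > 1" using CARD_field_ge_2[where 'f = 'f] q by simp
  have sub: "vec.subspace (U \<inter> A)" "vec.subspace (U \<inter> B)" "vec.subspace U" if "U \<in> ?L" for U
    using that A B by (auto simp: layer_def grass_vertices_def intro: vec.subspace_inter)
  have Z: "real (card (U \<inter> (B - A))) = q ^ Suc b - q ^ vec.dim (U \<inter> A)" if "U \<in> ?L" for U
  proof -
    have "U \<inter> (B - A) = (U \<inter> B) - (U \<inter> A)" by blast
    then show ?thesis
      using card_Diff_subspace[OF sub(1,2)[OF that]] AB(1) that q by (auto simp: layer_def)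
  qed
  have "(\<Sum>U\<in>?L. real (card (U \<inter> (B - A)))) = real (card ?P) * (q ^ Suc b - q ^ b)"
  proof (rule sum_card_Int_two_values)
    fix U assume U: "U \<in> ?L - ?P"
    then have "vec.dim (U \<inter> A) = Suc b"
      using dim_Int_hyperplane[OF A B AB sub(3)[of U]] by (auto simp: layer_def)
    then show "real (card (U \<inter> (B - A))) = 0" using Z U by simp
  qed (use Z in \<open>auto simp: layer_def\<close>)
  moreover have "(\<Sum>U\<in>?L. real (card (U \<inter> (B - {0})))) = real (card ?L) * (q ^ Suc b - 1)"
  proof -
    have "real (card (U \<inter> (B - {0}))) = q ^ Suc b - 1" if "U \<in> ?L" for U
    proof -
      have "U \<inter> (B - {0}) = (U \<inter> B) - {0}" by blast
      then show ?thesis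
        using card_Diff_subspace[of "{0}" "U \<inter> B"] sub(2)[OF that] vec.subspace_0[OF sub(2)[OF that]] that q
        by (auto simp: layer_def)
    qed
    then show ?thesis by simp
  qed
  moreover have "real (card (B - {0})) = q ^ vec.dim B - 1"
    using card_Diff_subspace[of "{0}" B] B vec.subspace_0[OF B] q by simp
  moreover have "real (card (B - A)) = q ^ vec.dim B - q ^ vec.dim A"
    using card_Diff_subspace[OF A B AB(1)] q by simp
  moreover have "card (B - {0}) * (\<Sum>U\<in>?L. card (U \<inter> (B - A))) = card (B - A) * (\<Sum>U\<in>?L. card (U \<inter> (B - {0})))"
    using vec.subspace_0[OF A] by (intro layer_double_count[OF B]) auto
  from arg_cong[OF this, of real]
  have "real (card (B - {0})) * (\<Sum>U\<in>?L. real (card (U \<inter> (B - A))))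
      = real (card (B - A)) * (\<Sum>U\<in>?L. real (card (U \<inter> (B - {0}))))" by simp
  ultimately have eq: "(q ^ vec.dim B - 1) * (real (card ?P) * (q ^ Suc b - q ^ b))
      = (q ^ vec.dim B - q ^ vec.dim A) * (real (card ?L) * (q ^ Suc b - 1))" by simp
  have "q ^ vec.dim A = q ^ (vec.dim B - Suc b) * q ^ b" using AB(2) b by (simp flip: power_add)
  then have e: "q ^ vec.dim B - q ^ vec.dim A = q ^ (vec.dim B - Suc b) * q ^ b * (q - 1)"
    by (simp add: AB(2) algebra_simps)
  \<comment> \<open>The factor to be cancelled, \<open>q ^ b * (q - 1)\<close>, is the number of
    vectors of \<open>B - A\<close> in a member of \<open>?P\<close>.\<close>
  have "(q ^ b * (q - 1)) * (real (card ?P) * (q ^ vec.dim B - 1))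
      = (q ^ vec.dim B - 1) * (real (card ?P) * (q ^ Suc b - q ^ b))"
    by (simp add: algebra_simps)
  also have "\<dots> = (q ^ b * (q - 1)) * (q ^ (vec.dim B - Suc b) * (q ^ Suc b - 1) * real (card ?L))"
    unfolding eq e by (simp only: mult_ac)
  finally have "(q ^ b * (q - 1)) * (real (card ?P) * (q ^ vec.dim B - 1))
      = (q ^ b * (q - 1)) * (q ^ (vec.dim B - Suc b) * (q ^ Suc b - 1) * real (card ?L))" .
  then show ?thesis using q1 by simp
qed

text \<open>Modulo \<open>A\<close>, a member of the layer of \<open>A\<close> has an image of
  dimension \<open>D - a\<close>, and it lies in layer \<open>Suc a\<close> of \<open>B\<close>
  exactly when that image contains the line B/A. The proportion is thus that of the nonzero quotient
  vectors in the image; counting vectors outside \<open>A\<close> avoids forming quotients.\<close>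

lemma card_layer_hyperplane_outer:
  fixes A B :: "('f::{field,finite} ^ 'n) set"
  assumes A: "vec.subspace A" and B: "vec.subspace B" and AB: "A \<subseteq> B" "vec.dim B = vec.dim A + 1"
    and a: "a \<le> D" and q: "q = real CARD('f)"
  shows "real (card (layer D A a \<inter> layer D B (Suc a))) * (q ^ (CARD('n) - vec.dim A) - 1)
    = (q ^ (D - a) - 1) * real (card (layer D A a))"
proof -
  let ?L = "layer D A a" and ?P = "layer D A a \<inter> layer D B (Suc a)"
  have q1: "q > 1" using CARD_field_ge_2[where 'f = 'f] q by simp
  have sub: "vec.subspace (U \<inter> A)" "vec.subspace (U \<inter> B)" "vec.subspace U" "vec.dim U = D" if "U \<in> ?L" for U
    using that A B by (auto simp: layer_def grass_vertices_def intro: vec.subspace_inter)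
  have Z: "real (card (U \<inter> (B - A))) = q ^ vec.dim (U \<inter> B) - q ^ a" if "U \<in> ?L" for U
  proof -
    have "U \<inter> (B - A) = (U \<inter> B) - (U \<inter> A)" by blast
    then show ?thesis
      using card_Diff_subspace[OF sub(1,2)[OF that]] AB(1) that q by (auto simp: layer_def)
  qed
  have "(\<Sum>U\<in>?L. real (card (U \<inter> (B - A)))) = real (card ?P) * (q ^ Suc a - q ^ a)"
  proof (rule sum_card_Int_two_values)
    fix U assume U: "U \<in> ?L - ?P"
    then have "vec.dim (U \<inter> B) = a"
      using dim_Int_hyperplane[OF A B AB sub(3)[of U]] by (auto simp: layer_def)
    then show "real (card (U \<inter> (B - A))) = 0" using Z U by simp
  qed (use Z in \<open>auto simp: layer_def\<close>)
  moreover have "(\<Sum>U\<in>?L. real (card (U \<inter> - A))) = real (card ?L) * (q ^ D - q ^ a)"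
  proof -
    have "real (card (U \<inter> - A)) = q ^ D - q ^ a" if "U \<in> ?L" for U
    proof -
      have "U \<inter> - A = U - (U \<inter> A)" by blast
      then show ?thesis
        using card_Diff_subspace[OF sub(1,3)[OF that]] sub(4)[OF that] that q
        by (auto simp: layer_def)
    qed
    then show ?thesis by simp
  qed
  moreover have N: "real (card (- A)) = q ^ CARD('n) - q ^ vec.dim A"
    using card_Diff_subspace[OF A vec.subspace_UNIV] q by (simp add: Compl_eq_Diff_UNIV card_cart_basis)
  moreover have "real (card (B - A)) = q ^ vec.dim B - q ^ vec.dim A"
    using card_Diff_subspace[OF A B AB(1)] q by simp
  moreover have "card (- A) * (\<Sum>U\<in>?L. card (U \<inter> (B - A))) = card (B - A) * (\<Sum>U\<in>?L. card (U \<inter> - A))"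
    by (intro layer_double_count[OF A]) auto
  from arg_cong[OF this, of real]
  have "real (card (- A)) * (\<Sum>U\<in>?L. real (card (U \<inter> (B - A))))
      = real (card (B - A)) * (\<Sum>U\<in>?L. real (card (U \<inter> - A)))" by simp
  ultimately have eq: "(q ^ CARD('n) - q ^ vec.dim A) * (real (card ?P) * (q ^ Suc a - q ^ a))
      = (q ^ vec.dim B - q ^ vec.dim A) * (real (card ?L) * (q ^ D - q ^ a))" by simp
  have "vec.dim A \<le> CARD('n)" using vec.dim_subset_UNIV[of A] by (simp add: vec.dimension_def card_cart_basis)
  then have "q ^ CARD('n) = q ^ (CARD('n) - vec.dim A) * q ^ vec.dim A" "q ^ D = q ^ (D - a) * q ^ a"
    using a by (simp_all flip: power_add)
  then have "(q ^ vec.dim A * q ^ a * (q - 1)) * (real (card ?P) * (q ^ (CARD('n) - vec.dim A) - 1))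
      = (q ^ vec.dim A * q ^ a * (q - 1)) * ((q ^ (D - a) - 1) * real (card ?L))"
    using eq AB(2) by (simp add: algebra_simps)
  then show ?thesis using q1 by simp
qed

section \<open>Delsarte cliques\<close>

text \<open>Two distinct members meet only in \<open>H\<close>, for reasons of dimension, so the
  sets \<open>U - H\<close> are disjoint subsets of \<open>R\<close> of equal size.\<close>

lemma card_packing_le:
  fixes P :: "('f::{field,finite} ^ 'n) set set"
  assumes H: "vec.subspace H"
    and P: "\<And>U. U \<in> P \<Longrightarrow> vec.subspace U \<and> vec.dim U = vec.dim H + 1 \<and> H \<subseteq> U \<and> U - H \<subseteq> R"
  shows "real (card P) * (real CARD('f) ^ vec.dim H * (real CARD('f) - 1)) \<le> real (card R)"
proof -
  have disj: "(U - H) \<inter> (V - H) = {}" if UV: "U \<in> P" "V \<in> P" "U \<noteq> V" for U V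
  proof -
    have sub: "vec.subspace (U \<inter> V)" using P UV by (intro vec.subspace_inter) auto
    have "\<not> vec.dim U \<le> vec.dim (U \<inter> V)"
    proof
      assume le: "vec.dim U \<le> vec.dim (U \<inter> V)"
      then have "U \<inter> V = U" using P UV sub by (intro subspace_eq_if_dim_le) auto
      moreover have "U \<inter> V = V" using P UV sub le by (intro subspace_eq_if_dim_le) auto
      ultimately show False using UV(3) by blast
    qed
    then have "H = U \<inter> V" using P UV H sub by (intro subspace_eq_if_dim_le) auto
    then show ?thesis by blast
  qed
  have "card (\<Union>U\<in>P. U - H) = (\<Sum>U\<in>P. card (U - H))"
    using disj by (intro card_UN_disjoint) auto
  then have "real (card (\<Union>U\<in>P. U - H)) = (\<Sum>U\<in>P. real (card (U - H)))" by simp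
  also have "\<dots> = (\<Sum>U\<in>P. real CARD('f) ^ vec.dim H * (real CARD('f) - 1))"
  proof (rule sum.cong)
    fix U assume "U \<in> P"
    then show "real (card (U - H)) = real CARD('f) ^ vec.dim H * (real CARD('f) - 1)"
      using card_Diff_subspace[OF H, of U] P[of U] by (simp add: algebra_simps)
  qed simp
  finally have "real (card P) * (real CARD('f) ^ vec.dim H * (real CARD('f) - 1)) = real (card (\<Union>U\<in>P. U - H))"
    by simp
  moreover have "card (\<Union>U\<in>P. U - H) \<le> card R" using P by (intro card_mono) auto
  ultimately show ?thesis by simp
qed

lemma card_superspaces_le:
  fixes S :: "('f::{field,finite} ^ 'n) set"
  assumes S: "vec.subspace S" "vec.dim S + 1 = D"
  shows "real (card {U \<in> grass_vertices D. S \<subseteq> U}) * (real CARD('f) - 1) \<le> real CARD('f) ^ (CARD('n) - D + 1) - 1"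
proof -
  let ?q = "real CARD('f)" and ?P = "{U \<in> grass_vertices D. S \<subseteq> U}"
  have q: "?q > 1" using CARD_field_ge_2[where 'f = 'f] by simp
  have "real (card ?P) * (?q ^ vec.dim S * (?q - 1)) \<le> real (card (UNIV - S))"
    using S by (intro card_packing_le) (auto simp: grass_vertices_def)
  also have "\<dots> = ?q ^ CARD('n) - ?q ^ vec.dim S"
    using card_Diff_subspace[OF S(1) vec.subspace_UNIV] by (simp add: card_cart_basis)
  finally have le: "real (card ?P) * (?q ^ vec.dim S * (?q - 1)) \<le> ?q ^ CARD('n) - ?q ^ vec.dim S" .
  show ?thesis
  proof (cases "D \<le> CARD('n)")
    case True
    then have "CARD('n) = vec.dim S + (CARD('n) - D + 1)" using S(2) by simp
    then have "?q ^ CARD('n) = ?q ^ vec.dim S * ?q ^ (CARD('n) - D + 1)" by (metis power_add)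
    then have "?q ^ vec.dim S * (real (card ?P) * (?q - 1)) \<le> ?q ^ vec.dim S * (?q ^ (CARD('n) - D + 1) - 1)"
      using le by (simp add: algebra_simps)
    then show ?thesis using q by (simp add: mult_le_cancel_left)
  next
    \<comment> \<open>There are no vertices here, and truncated subtraction turns the exponent into
      1, so the bound is still nonnegative.\<close>
    case False
    then have "?P = {}"
      using vec.dim_subset_UNIV by (auto simp: grass_vertices_def vec.dimension_def card_cart_basis)
    then show ?thesis using one_le_power[of ?q "CARD('n) - D + 1"] q by (simp only: card.empty) simp
  qed
qed

text \<open>Relative to one fixed hyperplane \<open>A\<close>, every other hyperplane meets
  \<open>A\<close> in a hyperplane \<open>H\<close> of \<open>A\<close>, and packing into
  \<open>T - A\<close> allows at most q of them for each \<open>H\<close>. If h(n) is the number in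
  dimension n, this reads h(n + 1) \<le> 1 + q h(n).\<close>

lemma card_hyperplanes_le:
  fixes T :: "('f::{field,finite} ^ 'n) set"
  assumes "vec.subspace T"
  shows "real (card {U. vec.subspace U \<and> U \<subseteq> T \<and> vec.dim U + 1 = vec.dim T}) * (real CARD('f) - 1)
    \<le> real CARD('f) ^ vec.dim T - 1"
  using assms
proof (induction "vec.dim T" arbitrary: T)
  case 0
  show ?case unfolding 0(1)[symmetric] by simp
next
  case (Suc n)
  let ?q = "real CARD('f)"
  have q: "?q > 1" using CARD_field_ge_2[where 'f = 'f] by simp
  let ?hyp = "\<lambda>T. {U. vec.subspace U \<and> U \<subseteq> T \<and> vec.dim U + 1 = vec.dim T}"
  have "{0} \<noteq> T" using Suc.hyps(2) by auto
  then obtain A where A: "vec.subspace A" "A \<subseteq> T" "vec.dim A + 1 = vec.dim T"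
    using ex_hyperplane_containing[of "{0}" T] Suc.prems vec.subspace_0[OF Suc.prems] by auto
  then have dA: "n = vec.dim A" using Suc.hyps(2) by simp
  define F where "F H = {U \<in> ?hyp T. U \<noteq> A \<and> U \<inter> A = H}" for H
  have fibre: "real (card (F H)) \<le> ?q" if "H \<in> ?hyp A" for H
  proof -
    have "real (card (F H)) * (?q ^ vec.dim H * (?q - 1)) \<le> real (card (T - A))"
      using that A(3) by (intro card_packing_le) (auto simp: F_def)
    also have "\<dots> = ?q * (?q ^ vec.dim H * (?q - 1))"
      using card_Diff_subspace[OF A(1) Suc.prems A(2)] A(3) that by (auto simp: algebra_simps simp flip: power_Suc)
    finally show ?thesis using q by (simp add: mult_le_cancel_right)
  qed
  have "?hyp T \<subseteq> insert A (\<Union>H\<in>?hyp A. F H)"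
  proof
    fix U assume U: "U \<in> ?hyp T"
    show "U \<in> insert A (\<Union>H\<in>?hyp A. F H)"
    proof (cases "U = A")
      case False
      have sub: "vec.subspace (U \<inter> A)" using U A by (intro vec.subspace_inter) auto
      have "\<not> vec.dim A \<le> vec.dim (U \<inter> A)"
      proof
        assume le: "vec.dim A \<le> vec.dim (U \<inter> A)"
        then have "U \<inter> A = A" using A sub by (intro subspace_eq_if_dim_le) auto
        moreover have "U \<inter> A = U" using U A sub le by (intro subspace_eq_if_dim_le) auto
        ultimately show False using False by blast
      qed
      moreover have "vec.dim (U \<inter> T) \<le> vec.dim (U \<inter> A) + 1"
        using A U Suc.prems by (intro dim_Int_hyperplane(2)) auto
      moreover have "U \<inter> T = U" using U by blast
      ultimately have "U \<inter> A \<in> ?hyp A" using sub U A(3) by auto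
      then show ?thesis using U False by (auto simp: F_def)
    qed simp
  qed
  then have "card (?hyp T) \<le> card (insert A (\<Union>H\<in>?hyp A. F H))" by (intro card_mono) auto
  also have "\<dots> \<le> Suc (card (\<Union>H\<in>?hyp A. F H))" by (simp add: card_insert_if)
  also have "\<dots> \<le> Suc (\<Sum>H\<in>?hyp A. card (F H))" using card_UN_le[of "?hyp A" F] by simp
  finally have "real (card (?hyp T)) \<le> 1 + (\<Sum>H\<in>?hyp A. real (card (F H)))"
    by (simp flip: of_nat_sum)
  also have "\<dots> \<le> 1 + (\<Sum>H\<in>?hyp A. ?q)" using fibre by (intro add_left_mono sum_mono)
  finally have "real (card (?hyp T)) \<le> 1 + real (card (?hyp A)) * ?q" by simp
  then have "real (card (?hyp T)) * (?q - 1) \<le> (1 + real (card (?hyp A)) * ?q) * (?q - 1)"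
    using q by (intro mult_right_mono) auto
  also have "\<dots> = (?q - 1) + ?q * (real (card (?hyp A)) * (?q - 1))" by (simp add: algebra_simps)
  also have "\<dots> \<le> (?q - 1) + ?q * (?q ^ vec.dim A - 1)"
    using Suc.hyps(1)[OF dA A(1)] q by (intro add_left_mono mult_left_mono) auto
  also have "\<dots> = ?q ^ vec.dim T - 1" using A(3) by (simp add: algebra_simps flip: power_Suc)
  finally show ?case .
qed

text \<open>A member outside the span of \<open>y\<close> and \<open>z\<close> and a member not
  containing \<open>y \<inter> z\<close> cannot coexist: they would meet inside a proper subspace of
  \<open>y \<inter> z\<close>, which is too small for adjacency.\<close>

lemma clique_star_or_top:
  fixes C :: "('f::field ^ 'n) set set"
  assumes sub: "C \<subseteq> grass_vertices D"
    and clique: "\<And>y z. y \<in> C \<Longrightarrow> z \<in> C \<Longrightarrow> y \<noteq> z \<Longrightarrow> (y, z) \<in> grass_edges D"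
    and yz: "y \<in> C" "z \<in> C" "y \<noteq> z"
  shows "(\<forall>w\<in>C. y \<inter> z \<subseteq> w) \<or> (\<forall>w\<in>C. w \<subseteq> vec.span (y \<union> z))"
proof -
  have V: "vec.subspace w" "vec.dim w = D" if "w \<in> C" for w
    using sub that by (auto simp: grass_vertices_def)
  have d: "vec.dim (v \<inter> w) + 1 = D" if "v \<in> C" "w \<in> C" "v \<noteq> w" for v w
    using clique[OF that] by (simp add: grass_edges_def)
  have T: "y \<subseteq> vec.span (y \<union> z)" "z \<subseteq> vec.span (y \<union> z)" by (auto intro: vec.span_base)
  \<comment> \<open>Apart from \<open>y\<close> and \<open>z\<close> themselves, \<open>w\<close>
    meets both in hyperplanes of \<open>w\<close>: if these coincide they equal
    \<open>y \<inter> z\<close>, otherwise they span \<open>w\<close>.\<close>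
  have either: "y \<inter> z \<subseteq> w \<or> w \<subseteq> vec.span (y \<union> z)" if w: "w \<in> C" for w
  proof (cases "w = y \<or> w = z")
    case True
    then show ?thesis by auto
  next
    case False
    let ?a = "w \<inter> y" and ?b = "w \<inter> z"
    have sub: "vec.subspace ?a" "vec.subspace ?b" "vec.subspace (?a \<inter> ?b)"
      using V w yz by (auto intro!: vec.subspace_inter)
    have da: "vec.dim ?a + 1 = D" "vec.dim ?b + 1 = D" "vec.dim (y \<inter> z) + 1 = D"
      using d w yz False by auto
    show ?thesis
    proof (cases "?a = ?b")
      case True
      have "?a = y \<inter> z"
      proof (rule subspace_eq_if_dim_le[OF sub(1)])
        show "vec.subspace (y \<inter> z)" using V(1) yz by (intro vec.subspace_inter)
        show "?a \<subseteq> y \<inter> z" using True by blast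
        show "vec.dim (y \<inter> z) \<le> vec.dim ?a" using da by linarith
      qed
      then show ?thesis by blast
    next
      case False
      have "\<not> vec.dim ?a \<le> vec.dim (?a \<inter> ?b)"
      proof
        assume le: "vec.dim ?a \<le> vec.dim (?a \<inter> ?b)"
        then have "?a \<inter> ?b = ?a" using sub by (intro subspace_eq_if_dim_le) auto
        moreover have "?a \<inter> ?b = ?b" using sub le da by (intro subspace_eq_if_dim_le) auto
        ultimately show False using False by blast
      qed
      then have "vec.dim w \<le> vec.dim (vec.span (?a \<union> ?b))"
        using dim_Un_Int[OF sub(1,2)] da V[OF w] by simp
      moreover have "vec.span (?a \<union> ?b) \<subseteq> w" using V[OF w] by (intro vec.span_minimal) auto
      ultimately have "vec.span (?a \<union> ?b) = w"
        using V[OF w] by (intro subspace_eq_if_dim_le) auto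
      moreover have "vec.span (?a \<union> ?b) \<subseteq> vec.span (y \<union> z)" by (intro vec.span_mono) blast
      ultimately show ?thesis by blast
    qed
  qed
  show ?thesis
  proof (rule ccontr)
    assume "\<not> ?thesis"
    then obtain u w where u: "u \<in> C" "\<not> u \<subseteq> vec.span (y \<union> z)" and w: "w \<in> C" "\<not> y \<inter> z \<subseteq> w" by blast
    have u': "y \<inter> z \<subseteq> u" and w': "w \<subseteq> vec.span (y \<union> z)" using either u w by blast+
    have dyz: "vec.dim (y \<inter> z) + 1 = D" using d yz by blast
    have sub: "vec.subspace (u \<inter> vec.span (y \<union> z))" "vec.subspace (y \<inter> z)" "vec.subspace (y \<inter> z \<inter> w)"
      using V u w yz by (auto intro!: vec.subspace_inter)
    have "\<not> vec.dim u \<le> vec.dim (u \<inter> vec.span (y \<union> z))"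
    proof
      assume "vec.dim u \<le> vec.dim (u \<inter> vec.span (y \<union> z))"
      then have "u \<inter> vec.span (y \<union> z) = u" using sub V u by (intro subspace_eq_if_dim_le) auto
      then show False using u by blast
    qed
    then have "y \<inter> z = u \<inter> vec.span (y \<union> z)"
      using sub dyz V(2)[OF u(1)] u' T by (intro subspace_eq_if_dim_le) auto
    then have uw: "u \<inter> w \<subseteq> y \<inter> z \<inter> w" using w' by blast
    have "u \<noteq> w" using u w' by blast
    then have "vec.dim (y \<inter> z) \<le> vec.dim (u \<inter> w)" using d u w dyz by fastforce
    also have "\<dots> \<le> vec.dim (y \<inter> z \<inter> w)" using uw by (rule vec.dim_subset)
    finally have "y \<inter> z \<inter> w = y \<inter> z" using sub by (intro subspace_eq_if_dim_le) auto
    then show False using w by blast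
  qed
qed

text \<open>The prescribed size is the upper bound for the family of vertices through a fixed
  \<open>(D - 1)\<close>-space, so in the first alternative the clique is that whole family. In the
  second it is bounded by the number of hyperplanes of a \<open>(D + 1)\<close>-space, and comparing
  exponents leaves only \<open>CARD('n) = 2 * D\<close>.\<close>

lemma delsarte_clique_cases:
  fixes C :: "('f::{field,finite} ^ 'n) set set"
  assumes C: "delsarte_clique D C" and D: "D \<ge> 1" "CARD('n) \<ge> 2 * D"
  obtains (star) S where "vec.subspace S" "vec.dim S + 1 = D" "C = {U \<in> grass_vertices D. S \<subseteq> U}"
  | (top) S where "vec.subspace S" "vec.dim S = D + 1" "C = {U \<in> grass_vertices D. U \<subseteq> S}" "CARD('n) = 2 * D"
proof -
  let ?q = "real CARD('f)" and ?N = "CARD('n) - D + 1"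
  have q: "?q > 1" using CARD_field_ge_2[where 'f = 'f] by simp
  have sub: "C \<subseteq> grass_vertices D"
    and clique: "\<And>y z. y \<in> C \<Longrightarrow> z \<in> C \<Longrightarrow> y \<noteq> z \<Longrightarrow> (y, z) \<in> grass_edges D"
    and "real (card C) = (?q ^ ?N - 1) / (?q - 1)"
    using C by (auto simp: delsarte_clique_def)
  then have cC: "real (card C) * (?q - 1) = ?q ^ ?N - 1" using q by simp
  \<comment> \<open>The exponent is at least 2, so the clique has two distinct members to start
    from.\<close>
  have "?q ^ 1 < ?q ^ ?N" using q D by (intro power_strict_increasing) auto
  then have "1 * (?q - 1) < real (card C) * (?q - 1)" unfolding cC by simp
  then have "1 < card C" using q by (simp only: mult_less_cancel_right) auto
  then have "\<not> is_singleton C" "C \<noteq> {}" by (auto simp: is_singleton_altdef)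
  then obtain y z where yz: "y \<in> C" "z \<in> C" "y \<noteq> z" by (metis is_singletonI' )
  have V: "vec.subspace y" "vec.dim y = D" "vec.subspace z" "vec.dim z = D"
    using sub yz by (auto simp: grass_vertices_def)
  have d: "vec.dim (y \<inter> z) + 1 = D" using clique[OF yz] by (simp add: grass_edges_def)
  consider "\<forall>w\<in>C. y \<inter> z \<subseteq> w" | "\<forall>w\<in>C. w \<subseteq> vec.span (y \<union> z)"
    using clique_star_or_top[OF sub clique yz] by blast
  then show thesis
  proof cases
    case 1
    let ?P = "{U \<in> grass_vertices D. y \<inter> z \<subseteq> U}"
    have yz': "vec.subspace (y \<inter> z)" using V by (intro vec.subspace_inter)
    have "real (card ?P) * (?q - 1) \<le> real (card C) * (?q - 1)"
      unfolding cC using card_superspaces_le[OF yz' d] .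
    then have "card ?P \<le> card C" using q by simp
    then have "C = ?P" using 1 sub by (intro card_seteq) auto
    then show thesis using star yz' d by blast
  next
    case 2
    let ?T = "vec.span (y \<union> z)"
    let ?P = "{U \<in> grass_vertices D. U \<subseteq> ?T}"
    have dT: "vec.dim ?T = D + 1" using dim_Un_Int[OF V(1,3)] V d by simp
    have P: "?P = {U. vec.subspace U \<and> U \<subseteq> ?T \<and> vec.dim U + 1 = vec.dim ?T}"
      unfolding dT by (auto simp: grass_vertices_def)
    have leP: "real (card ?P) * (?q - 1) \<le> ?q ^ (D + 1) - 1"
      using card_hyperplanes_le[of ?T] unfolding P dT by simp
    have "card C \<le> card ?P" using 2 sub by (intro card_mono) auto
    then have "real (card C) * (?q - 1) \<le> real (card ?P) * (?q - 1)" using q by (intro mult_right_mono) auto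
    then have "?q ^ ?N \<le> ?q ^ (D + 1)" using cC leP by linarith
    then have "?N \<le> D + 1" using q by (simp only: power_increasing_iff)
    then have N: "CARD('n) = 2 * D" using D by simp
    then have "real (card ?P) * (?q - 1) \<le> real (card C) * (?q - 1)" using leP cC by simp
    then have "card ?P \<le> card C" using q by simp
    then have "C = ?P" using 2 sub by (intro card_seteq) auto
    then show thesis using top[of ?T] dT N by simp
  qed
qed

text \<open>A clique member contains \<open>S\<close> as a hyperplane, so it meets \<open>y\<close>
  in at most one dimension more than \<open>S\<close> does; adding to \<open>S\<close> a vector of
  \<open>y\<close> outside \<open>S\<close> attains this.\<close>

lemma Min_path_dist_star:
  fixes S y :: "('f::{field,finite} ^ 'n) set"
  assumes S: "vec.subspace S" "vec.dim S + 1 = D" and y: "y \<in> grass_vertices D"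
  shows "Min (path_dist (grass_edges D) y ` {U \<in> grass_vertices D. S \<subseteq> U}) = D - 1 - vec.dim (y \<inter> S)"
proof (rule Min_eqI)
  note y' = grass_verticesD[OF y]
  let ?C = "{U \<in> grass_vertices D. S \<subseteq> U}"
  show "D - 1 - vec.dim (y \<inter> S) \<le> d" if d: "d \<in> path_dist (grass_edges D) y ` ?C" for d
  proof -
    obtain U where "U \<in> ?C" "d = path_dist (grass_edges D) y U" using d by blast
    then have U: "U \<in> ?C" "d = D - vec.dim (y \<inter> U)"
      using path_dist_grass_edges[OF y, of U] by simp_all
    then have "vec.dim (y \<inter> U) \<le> vec.dim (y \<inter> S) + 1"
      using S y'(1) by (intro dim_Int_hyperplane(2)) (auto simp: grass_vertices_def)
    then show ?thesis using U(2) by simp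
  qed
  have "\<not> y \<subseteq> S" using vec.dim_subset[of y S] y'(2) S(2) by auto
  then obtain v where v: "v \<in> y" "v \<notin> S" by blast
  let ?U = "vec.span (insert v S)"
  have U: "?U \<in> ?C"
    using dim_span_insert[OF S(1) v(2)] S(2) by (auto simp: grass_vertices_def intro: vec.span_base)
  then have "vec.dim (y \<inter> ?U) \<le> vec.dim (y \<inter> S) + 1"
    using S y'(1) by (intro dim_Int_hyperplane(2)) (auto simp: grass_vertices_def)
  moreover have "vec.span (insert v (y \<inter> S)) \<subseteq> y \<inter> ?U"
    using v(1) y'(1) by (intro vec.span_minimal vec.subspace_inter) (auto intro: vec.span_base)
  then have "vec.dim (vec.span (insert v (y \<inter> S))) \<le> vec.dim (y \<inter> ?U)" by (rule vec.dim_subset)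
  then have "vec.dim (y \<inter> S) + 1 \<le> vec.dim (y \<inter> ?U)"
    using dim_span_insert[OF vec.subspace_inter[OF y'(1) S(1)], of v] v(2) by auto
  ultimately have "path_dist (grass_edges D) y ?U = D - 1 - vec.dim (y \<inter> S)"
    using U path_dist_grass_edges[OF y, of ?U] by simp
  then show "D - 1 - vec.dim (y \<inter> S) \<in> path_dist (grass_edges D) y ` ?C" by (rule image_eqI[OF sym U])
qed simp

text \<open>A vertex inside \<open>S\<close> cannot meet \<open>y\<close> in more than
  \<open>y \<inter> S\<close>, and a hyperplane of \<open>S\<close> containing
  \<open>y \<inter> S\<close> loses nothing.\<close>

lemma Min_path_dist_top:
  fixes S y :: "('f::{field,finite} ^ 'n) set"
  assumes S: "vec.subspace S" "vec.dim S = D + 1" and y: "y \<in> grass_vertices D"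
  shows "Min (path_dist (grass_edges D) y ` {U \<in> grass_vertices D. U \<subseteq> S}) = D - vec.dim (y \<inter> S)"
proof (rule Min_eqI)
  note y' = grass_verticesD[OF y]
  let ?C = "{U \<in> grass_vertices D. U \<subseteq> S}"
  show "D - vec.dim (y \<inter> S) \<le> d" if d: "d \<in> path_dist (grass_edges D) y ` ?C" for d
  proof -
    obtain U where "U \<in> ?C" "d = path_dist (grass_edges D) y U" using d by blast
    then have U: "U \<in> ?C" "d = D - vec.dim (y \<inter> U)"
      using path_dist_grass_edges[OF y, of U] by simp_all
    then have "vec.dim (y \<inter> U) \<le> vec.dim (y \<inter> S)" by (intro vec.dim_subset) auto
    then show ?thesis using U(2) by simp
  qed
  have "y \<inter> S \<noteq> S" using grass_vertices_dim_Int_le[OF y, of S] S(2) by auto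
  then obtain U where U: "vec.subspace U" "y \<inter> S \<subseteq> U" "U \<subseteq> S" "vec.dim U + 1 = vec.dim S"
    using ex_hyperplane_containing[OF vec.subspace_inter[OF y'(1) S(1)] S(1)] by auto
  have UC: "U \<in> ?C" using U S(2) by (simp add: grass_vertices_def)
  have "y \<inter> U = y \<inter> S" using U by blast
  then have "path_dist (grass_edges D) y U = D - vec.dim (y \<inter> S)"
    using UC path_dist_grass_edges[OF y, of U] by simp
  then show "D - vec.dim (y \<inter> S) \<in> path_dist (grass_edges D) y ` ?C" by (rule image_eqI[OF sym UC])
qed simp

section \<open>Cells as intersections of two layers\<close>

lemma cells_eq_layers:
  fixes S x :: "('f::{field,finite} ^ 'n) set"
  assumes x: "x \<in> grass_vertices D"
    and M: "\<And>y. y \<in> grass_vertices D \<Longrightarrow> Min (path_dist (grass_edges D) y ` C) = m - vec.dim (y \<inter> S)"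
    and le: "\<And>y. y \<in> grass_vertices D \<Longrightarrow> vec.dim (y \<inter> S) \<le> m"
    and i: "i < D" "i \<le> m"
  shows "cell_minus D C x i = layer D x (D - i) \<inter> layer D S (m - i)"
    and "cell_plus D C x i = layer D x (D - Suc i) \<inter> layer D S (m - i)"
proof -
  have "y \<in> cell D C i \<longleftrightarrow> y \<in> layer D S (m - i)" for y
    using M[of y] le[of y] i by (auto simp: cell_def layer_def)
  moreover have "path_dist (grass_edges D) x y = i \<longleftrightarrow> y \<in> layer D x (D - i)"
    and "path_dist (grass_edges D) x y = i + 1 \<longleftrightarrow> y \<in> layer D x (D - Suc i)" if "y \<in> grass_vertices D" for y
    using path_dist_grass_edges[OF x that] grass_vertices_dim_Int_le[OF that, of x] that i
    by (auto simp: layer_def Int_commute)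
  ultimately show "cell_minus D C x i = layer D x (D - i) \<inter> layer D S (m - i)"
    and "cell_plus D C x i = layer D x (D - Suc i) \<inter> layer D S (m - i)"
    unfolding cell_minus_def cell_plus_def using layer_subset by blast+
qed

lemma layer_hyperplane_partition:
  fixes A B :: "('f::{field,finite} ^ 'n) set"
  assumes A: "vec.subspace A" and B: "vec.subspace B" and AB: "A \<subseteq> B" "vec.dim B = vec.dim A + 1"
  shows "layer D A a = (layer D A a \<inter> layer D B (Suc a)) \<union> (layer D A a \<inter> layer D B a)"
    and "layer D B (Suc a) = (layer D A a \<inter> layer D B (Suc a)) \<union> (layer D A (Suc a) \<inter> layer D B (Suc a))"
proof -
  have "vec.dim (U \<inter> B) = vec.dim (U \<inter> A) \<or> vec.dim (U \<inter> B) = Suc (vec.dim (U \<inter> A))"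
    if "U \<in> grass_vertices D" for U
    using dim_Int_hyperplane[OF A B AB, of U] grass_verticesD[OF that] by auto
  then show "layer D A a = (layer D A a \<inter> layer D B (Suc a)) \<union> (layer D A a \<inter> layer D B a)"
    and "layer D B (Suc a) = (layer D A a \<inter> layer D B (Suc a)) \<union> (layer D A (Suc a) \<inter> layer D B (Suc a))"
    unfolding layer_def by fastforce+
qed

lemma layer_Suc_disjoint: "layer D S (Suc a) \<inter> layer D S a = {}"
  by (auto simp: layer_def)

lemma real_card_Un_disjoint:
  fixes P R :: "'a::finite set"
  shows "P \<inter> R = {} \<Longrightarrow> real (card (P \<union> R)) = real (card P) + real (card R)"
  by (simp add: card_Un_disjoint)

text \<open>Both kinds of clique are brought to one list of facts, after which they need not be
  distinguished. Layers of the larger subspace take the inner count and layers of the smaller the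
  outer one, so the inner count serves the layers of \<open>x\<close> in case \<open>star\<close>
  and those of \<open>S\<close> in case \<open>top\<close>.\<close>

lemma delsarte_clique_cells:
  fixes C :: "('f::{field,finite} ^ 'n) set set"
  assumes C: "delsarte_clique D C" and D: "D \<ge> 1" "CARD('n) \<ge> 2 * D" and x: "x \<in> C"
    and q: "q = real CARD('f)"
  obtains S m where "vec.subspace S" "m = min D (vec.dim S)" "C = layer D S m"
    "layer D x D = cell_minus D C x 0" "layer D x 0 = cell_plus D C x (D - 1)"
    "\<And>i. i \<in> {1..D - 1} \<Longrightarrow> layer D x (D - i) = cell_plus D C x (i - 1) \<union> cell_minus D C x i"
    "\<And>i. i \<in> {1..D - 1} \<Longrightarrow> cell_plus D C x (i - 1) \<inter> cell_minus D C x i = {}"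
    "\<And>i. i \<in> {1..D - 1} \<Longrightarrow>
      real (card (cell_plus D C x (i - 1))) * (q ^ D - 1) = (q ^ i - 1) * real (card (layer D x (D - i)))"
    "\<And>i. i < D \<Longrightarrow> layer D S (m - i) = cell_minus D C x i \<union> cell_plus D C x i"
    "\<And>i. i < D \<Longrightarrow> cell_minus D C x i \<inter> cell_plus D C x i = {}"
    "\<And>i. i < D \<Longrightarrow> real (card (cell_minus D C x i)) * (q ^ (CARD('n) - D + 1) - 1)
      = (q ^ (i + 1) - 1) * real (card (layer D S (m - i)))"
proof -
  have xX: "x \<in> grass_vertices D" using C x by (auto simp: delsarte_clique_def)
  note x' = grass_verticesD[OF xX]
  show thesis
    using C D
  proof (cases rule: delsarte_clique_cases)
    case (star S)
    have xS: "S \<subseteq> x" "vec.dim x = vec.dim S + 1" using star x x'(2) by auto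
    note hyp = star(1) x'(1) xS
    have M: "Min (path_dist (grass_edges D) y ` C) = D - 1 - vec.dim (y \<inter> S)" if "y \<in> grass_vertices D" for y
      unfolding star(3) by (rule Min_path_dist_star[OF star(1,2) that])
    have le: "vec.dim (y \<inter> S) \<le> D - 1" for y using vec.dim_subset[of "y \<inter> S" S] star(2) by auto
    have cells: "cell_minus D C x i = layer D x (D - i) \<inter> layer D S (D - 1 - i)"
      "cell_plus D C x i = layer D x (D - Suc i) \<inter> layer D S (D - 1 - i)" if "i < D" for i
      using cells_eq_layers[OF xX M le] that by auto
    show thesis
    proof (rule that)
      show "vec.subspace S" by fact
      show m: "D - 1 = min D (vec.dim S)" using star(2) by simp
      have "S \<subseteq> U \<longleftrightarrow> vec.dim (U \<inter> S) = D - 1" if "U \<in> grass_vertices D" for U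
      proof
        assume "S \<subseteq> U"
        then have "U \<inter> S = S" by blast
        then show "vec.dim (U \<inter> S) = D - 1" using star(2) by simp
      next
        assume "vec.dim (U \<inter> S) = D - 1"
        then have "U \<inter> S = S"
          using star grass_verticesD[OF that] by (intro subspace_eq_if_dim_le vec.subspace_inter) auto
        then show "S \<subseteq> U" by blast
      qed
      then show "C = layer D S (D - 1)" using star(3) by (auto simp: layer_def)
      \<comment> \<open>The second part lies in layer \<open>D\<close> of \<open>S\<close>, which is
        empty because \<open>S\<close> has dimension \<open>D - 1\<close>.\<close>
      have "layer D x (Suc (D - 1)) = (layer D S (D - 1) \<inter> layer D x (Suc (D - 1))) \<union> (layer D S (Suc (D - 1)) \<inter> layer D x (Suc (D - 1)))"
        by (rule layer_hyperplane_partition(2)[OF hyp])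
      moreover have "layer D S (Suc (D - 1)) = {}" using star(2) by (intro layer_empty) auto
      ultimately show "layer D x D = cell_minus D C x 0" using cells(1)[of 0] D(1) by auto
      have "layer D x 0 \<subseteq> layer D S 0"
      proof
        fix U assume "U \<in> layer D x 0"
        then have U: "U \<in> grass_vertices D" "vec.dim (U \<inter> x) = 0" by (simp_all add: layer_def del: vec.dim_eq_0)
        then have "vec.dim (U \<inter> S) = 0"
          using dim_Int_hyperplane(1)[OF hyp grass_verticesD(1)[OF U(1)]] by linarith
        then show "U \<in> layer D S 0" using U(1) by (simp add: layer_def del: vec.dim_eq_0)
      qed
      then show "layer D x 0 = cell_plus D C x (D - 1)" using cells(2)[of "D - 1"] D(1) by auto
    next
      fix i assume i: "i \<in> {1..D - 1}"
      have e: "D - i = Suc (D - 1 - i)" "D - 1 - (i - 1) = D - i" "Suc (i - 1) = i" "D - Suc i = D - 1 - i" using i by auto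
      have i': "i - 1 < D" "i < D" using i by auto
      have c: "cell_plus D C x (i - 1) = layer D S (Suc (D - 1 - i)) \<inter> layer D x (Suc (D - 1 - i))"
        "cell_minus D C x i = layer D S (D - 1 - i) \<inter> layer D x (Suc (D - 1 - i))"
        using cells(2)[OF i'(1)] cells(1)[OF i'(2)] unfolding e by blast+
      show un: "layer D x (D - i) = cell_plus D C x (i - 1) \<union> cell_minus D C x i"
        unfolding c e(1) using layer_hyperplane_partition(2)[OF hyp, of D "D - 1 - i"] by blast
      show disj: "cell_plus D C x (i - 1) \<inter> cell_minus D C x i = {}"
        unfolding c using layer_Suc_disjoint[of D S "D - 1 - i"] by blast
      \<comment> \<open>The inner count measures the other cell of the pair; the required one
        follows by taking complements in the layer.\<close>
      have "real (card (cell_minus D C x i)) * (q ^ D - 1)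
          = q ^ i * (q ^ (D - i) - 1) * real (card (layer D x (D - i)))"
      proof -
        have "vec.dim x - Suc (D - 1 - i) = i" "Suc (D - 1 - i) \<le> vec.dim x" using x'(2) i by auto
        then show ?thesis
          using card_layer_hyperplane_inner[OF hyp, of "D - 1 - i" q D] q x'(2) unfolding c e(1) by simp
      qed
      moreover have "q ^ i * (q ^ (D - i) - 1) = q ^ D - q ^ i"
      proof -
        have "i + (D - i) = D" using i by auto
        then have "q ^ i * q ^ (D - i) = q ^ D" by (simp flip: power_add)
        then show ?thesis by (simp add: right_diff_distrib)
      qed
      ultimately have "real (card (cell_minus D C x i)) * (q ^ D - 1) = (q ^ D - q ^ i) * real (card (layer D x (D - i)))"
        by (simp only:)
      then show "real (card (cell_plus D C x (i - 1))) * (q ^ D - 1) = (q ^ i - 1) * real (card (layer D x (D - i)))"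
        unfolding un real_card_Un_disjoint[OF disj] by (simp add: algebra_simps)
    next
      fix i assume i: "i < D"
      have e: "D - i = Suc (D - 1 - i)" "D - Suc i = D - 1 - i" using i by auto
      have c: "cell_minus D C x i = layer D S (D - 1 - i) \<inter> layer D x (Suc (D - 1 - i))"
        "cell_plus D C x i = layer D S (D - 1 - i) \<inter> layer D x (D - 1 - i)"
        using cells[OF i] unfolding e by blast+
      show "layer D S (D - 1 - i) = cell_minus D C x i \<union> cell_plus D C x i"
        unfolding c by (rule layer_hyperplane_partition(1)[OF hyp])
      show "cell_minus D C x i \<inter> cell_plus D C x i = {}"
        unfolding c using layer_Suc_disjoint[of D x "D - 1 - i"] by blast
      have "CARD('n) - vec.dim S = CARD('n) - D + 1" "D - (D - 1 - i) = i + 1" using star(2) D i by auto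
      then show "real (card (cell_minus D C x i)) * (q ^ (CARD('n) - D + 1) - 1)
          = (q ^ (i + 1) - 1) * real (card (layer D S (D - 1 - i)))"
        using card_layer_hyperplane_outer[OF hyp, of "D - 1 - i" D q] q unfolding c by simp
    qed
  next
    case (top S)
    have xS: "x \<subseteq> S" "vec.dim S = vec.dim x + 1" using top x x'(2) by auto
    note hyp = x'(1) top(1) xS
    have M: "Min (path_dist (grass_edges D) y ` C) = D - vec.dim (y \<inter> S)" if "y \<in> grass_vertices D" for y
      unfolding top(3) by (rule Min_path_dist_top[OF top(1,2) that])
    have cells: "cell_minus D C x i = layer D x (D - i) \<inter> layer D S (D - i)"
      "cell_plus D C x i = layer D x (D - Suc i) \<inter> layer D S (D - i)" if "i < D" for i
      using cells_eq_layers[OF xX M grass_vertices_dim_Int_le] that by auto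
    show thesis
    proof (rule that)
      show "vec.subspace S" by fact
      show m: "D = min D (vec.dim S)" using top(2) by simp
      have "U \<subseteq> S \<longleftrightarrow> vec.dim (U \<inter> S) = D" if "U \<in> grass_vertices D" for U
      proof
        assume "U \<subseteq> S"
        then have "U \<inter> S = U" by blast
        then show "vec.dim (U \<inter> S) = D" using grass_verticesD[OF that] by simp
      next
        assume "vec.dim (U \<inter> S) = D"
        then have "U \<inter> S = U"
          using top grass_verticesD[OF that] by (intro subspace_eq_if_dim_le vec.subspace_inter) auto
        then show "U \<subseteq> S" by blast
      qed
      then show "C = layer D S D" using top(3) by (auto simp: layer_def)
      have "layer D x D = (layer D x D \<inter> layer D S (Suc D)) \<union> (layer D x D \<inter> layer D S D)"
        by (rule layer_hyperplane_partition(1)[OF hyp])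
      moreover have "layer D S (Suc D) = {}" by (intro layer_empty) auto
      ultimately show "layer D x D = cell_minus D C x 0" using cells(1)[of 0] D(1) by auto
      \<comment> \<open>As the ambient dimension is \<open>2 * D\<close>, subspaces of dimensions
        \<open>D\<close> and \<open>D + 1\<close> cannot meet trivially; hence the last layer of
        \<open>x\<close> is a single cell.\<close>
      have "layer D S 0 = {}"
      proof -
        have "vec.dim (U \<inter> S) \<noteq> 0" if "U \<in> grass_vertices D" for U
        proof -
          have "vec.dim (vec.span (U \<union> S)) \<le> CARD('n)"
            using vec.dim_subset_UNIV[of "vec.span (U \<union> S)"] by (simp add: vec.dimension_def card_cart_basis)
          then show ?thesis
            using dim_Un_Int[OF grass_verticesD(1)[OF that] top(1)] grass_verticesD(2)[OF that] top(2,4) by linarith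
        qed
        then show ?thesis by (auto simp: layer_def)
      qed
      then show "layer D x 0 = cell_plus D C x (D - 1)"
        using layer_hyperplane_partition(1)[OF hyp, of D 0] cells(2)[of "D - 1"] D(1) by auto
    next
      fix i assume i: "i \<in> {1..D - 1}"
      have e: "D - (i - 1) = Suc (D - i)" "Suc (i - 1) = i" using i by auto
      have i': "i - 1 < D" "i < D" using i by auto
      have c: "cell_plus D C x (i - 1) = layer D x (D - i) \<inter> layer D S (Suc (D - i))"
        "cell_minus D C x i = layer D x (D - i) \<inter> layer D S (D - i)"
        using cells(2)[OF i'(1)] cells(1)[OF i'(2)] unfolding e by blast+
      show "layer D x (D - i) = cell_plus D C x (i - 1) \<union> cell_minus D C x i"
        unfolding c by (rule layer_hyperplane_partition(1)[OF hyp])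
      show "cell_plus D C x (i - 1) \<inter> cell_minus D C x i = {}"
        unfolding c using layer_Suc_disjoint[of D S "D - i"] by blast
      show "real (card (cell_plus D C x (i - 1))) * (q ^ D - 1) = (q ^ i - 1) * real (card (layer D x (D - i)))"
      proof -
        \<comment> \<open>Here \<open>x\<close> has codimension \<open>D\<close>, so the outer count
          produces the same denominator as the inner count does for the other kind of
          clique.\<close>
        have "D - (D - i) = i" "CARD('n) - vec.dim x = D" using i x'(2) top(4) by auto
        then show ?thesis using card_layer_hyperplane_outer[OF hyp, of "D - i" D q] q unfolding c by simp
      qed
    next
      fix i assume i: "i < D"
      have e: "D - i = Suc (D - Suc i)" using i by auto
      have c: "cell_minus D C x i = layer D x (Suc (D - Suc i)) \<inter> layer D S (Suc (D - Suc i))"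
        "cell_plus D C x i = layer D x (D - Suc i) \<inter> layer D S (Suc (D - Suc i))"
        using cells[OF i] unfolding e by blast+
      show un: "layer D S (D - i) = cell_minus D C x i \<union> cell_plus D C x i"
        unfolding c e using layer_hyperplane_partition(2)[OF hyp, of D "D - Suc i"] by blast
      show disj: "cell_minus D C x i \<inter> cell_plus D C x i = {}"
        unfolding c using layer_Suc_disjoint[of D x "D - Suc i"] by blast
      have "real (card (cell_plus D C x i)) * (q ^ (D + 1) - 1)
          = q ^ (i + 1) * (q ^ (D - i) - 1) * real (card (layer D S (D - i)))"
      proof -
        have "vec.dim S - Suc (D - Suc i) = i + 1" "Suc (D - Suc i) \<le> vec.dim S" using top(2) i by auto
        then show ?thesis
          using card_layer_hyperplane_inner[OF hyp, of "D - Suc i" q D] q top(2) unfolding c e by simp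
      qed
      moreover have "q ^ (i + 1) * (q ^ (D - i) - 1) = q ^ (D + 1) - q ^ (i + 1)"
      proof -
        have "(i + 1) + (D - i) = D + 1" using i by auto
        then have "q ^ (i + 1) * q ^ (D - i) = q ^ (D + 1)" by (simp only: power_add[symmetric])
        then show ?thesis by (simp only: right_diff_distrib mult_1_right)
      qed
      moreover have "CARD('n) - D + 1 = D + 1" using top(4) by simp
      ultimately have "real (card (cell_plus D C x i)) * (q ^ (CARD('n) - D + 1) - 1)
          = (q ^ (CARD('n) - D + 1) - q ^ (i + 1)) * real (card (layer D S (D - i)))"
        by (simp only:)
      then show "real (card (cell_minus D C x i)) * (q ^ (CARD('n) - D + 1) - 1)
          = (q ^ (i + 1) - 1) * real (card (layer D S (D - i)))"
        unfolding un real_card_Un_disjoint[OF disj] by (simp add: algebra_simps)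
    qed
  qed
qed

section \<open>The projection formulas\<close>

lemma char_vec_Un_disjoint: "P \<inter> R = {} \<Longrightarrow> char_vec (P \<union> R) = char_vec P + char_vec R"
  by (auto simp: char_vec_def vec_eq_iff)

text \<open>Since \<open>k\<^sup>2 \<beta> = -1\<close>, the block of \<open>(T + k\<^sup>-\<^sup>1) / (k + k\<^sup>-\<^sup>1)\<close> on \<open>P, R\<close> has both rows equal to
  \<open>((1 - \<alpha>) / (1 - \<beta>), (\<alpha> - \<beta>) / (1 - \<beta>))\<close>, which are the proportions of \<open>P\<close> and \<open>R\<close> in the layer.\<close>

lemma block_projection:
  fixes S :: "('f::{field,finite} ^ 'n) set" and \<alpha> \<beta> :: real and k :: complex
  assumes L: "layer D S j = P \<union> R" "P \<inter> R = {}"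
    and count: "real (card P) * (\<beta> - 1) = (\<alpha> - 1) * real (card (layer D S j))"
    and \<beta>: "\<beta> \<noteq> 1" and k: "k * k * of_real \<beta> = - 1"
    and TP: "T (char_vec P) = (k * (1 - of_real \<alpha> + of_real \<beta>)) *s char_vec P + (k * (1 - of_real \<alpha>)) *s char_vec R"
    and TR: "T (char_vec R) = (k * (of_real \<alpha> - of_real \<beta>)) *s char_vec P + (k * of_real \<alpha>) *s char_vec R"
    and u: "u = char_vec P \<or> u = char_vec R"
  shows "inverse (k + inverse k) *s (T u + inverse k *s u) \<in> layer_span D S"
    and "\<And>s. s \<in> layer_span D S \<Longrightarrow> hermitian_inner (u - inverse (k + inverse k) *s (T u + inverse k *s u)) s = 0"
proof -
  let ?a = "complex_of_real \<alpha>" and ?b = "complex_of_real \<beta>" and ?L = "layer D S j"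
  define c where "c = (1 - ?a) / (1 - ?b)"
  have b1: "1 - ?b \<noteq> 0" using \<beta> by (metis of_real_1 of_real_eq_iff right_minus_eq)
  have k0: "k \<noteq> 0" using k by auto
  have ik: "inverse k = - (k * ?b)"
    using k k0 by (simp add: field_simps)
  have g: "inverse (k + inverse k) = inverse k / (1 - ?b)"
  proof -
    have "k + inverse k = k * (1 - ?b)" unfolding ik by (simp add: algebra_simps)
    then show ?thesis by (simp add: divide_inverse)
  qed
  have cL: "char_vec ?L = char_vec P + char_vec R" using char_vec_Un_disjoint[OF L(2)] L(1) by simp
  have "T (char_vec P) + inverse k *s char_vec P = (k * (1 - ?a)) *s char_vec ?L"
    unfolding TP ik cL by (simp add: vec_eq_iff algebra_simps)
  then have pP: "inverse (k + inverse k) *s (T (char_vec P) + inverse k *s char_vec P) = c *s char_vec ?L"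
    unfolding g c_def using k0 by (simp add: vec.scale_scale)
  have "T (char_vec R) + inverse k *s char_vec R = (k * (?a - ?b)) *s char_vec ?L"
    unfolding TR ik cL by (simp add: vec_eq_iff algebra_simps)
  moreover have "(?a - ?b) / (1 - ?b) = 1 - c" unfolding c_def using b1 by (simp add: field_simps)
  moreover have "inverse k / (1 - ?b) * (k * (?a - ?b)) = (?a - ?b) / (1 - ?b)"
    using k0 by (simp add: divide_simps)
  ultimately have pR: "inverse (k + inverse k) *s (T (char_vec R) + inverse k *s char_vec R) = (1 - c) *s char_vec ?L"
    unfolding g by (simp only: vec.scale_scale)
  have "complex_of_real (real (card P) * (\<beta> - 1)) = complex_of_real ((\<alpha> - 1) * real (card ?L))"
    unfolding count ..
  then have "of_nat (card P) * (?b - 1) = (?a - 1) * of_nat (card ?L)" by simp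
  then have "(1 - ?a) * of_nat (card ?L) = of_nat (card P) * (1 - ?b)" by (simp add: algebra_simps)
  then have cP: "c * of_nat (card ?L) = of_nat (card P)" unfolding c_def using b1 by (simp add: field_simps)
  have "of_nat (card ?L) = (of_nat (card P) + of_nat (card R) :: complex)"
    unfolding L(1) using L(2) by (simp add: card_Un_disjoint)
  then have cR: "(1 - c) * of_nat (card ?L) = of_nat (card R)" using cP by (simp add: algebra_simps)
  have sub: "P \<subseteq> ?L" "R \<subseteq> ?L" using L(1) by auto
  show "inverse (k + inverse k) *s (T u + inverse k *s u) \<in> layer_span D S"
    using u layer_projection(1)[OF sub(1) cP pP] layer_projection(1)[OF sub(2) cR pR] by auto
  show "hermitian_inner (u - inverse (k + inverse k) *s (T u + inverse k *s u)) s = 0" if "s \<in> layer_span D S" for s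
    using u layer_projection(2)[OF sub(1) cP pP that] layer_projection(2)[OF sub(2) cR pR that] by auto
qed

text \<open>Used with \<open>e = N - D + 1\<close> for \<open>k\<close> and \<open>e = D\<close> for
  \<open>k'\<close>. A block with parameters \<alpha>, \<beta> has trace k (1 + \<beta>) and
  determinant k^2 \<beta>, hence eigenvalues k and k \<beta>. The relation says that the second is
  -1/k, the eigenvalue sent to 0 by the affine normalisation, which sends k to 1.\<close>

lemma sqrt_minus_power_square:
  assumes "q > 0" and k: "k = \<i> * complex_of_real (q powr (- real e / 2))"
  shows "k * k * of_real (q ^ e) = - 1"
proof -
  have "q powr (- real e / 2) * q powr (- real e / 2) * q ^ e = 1"
    using assms(1) by (simp flip: powr_realpow powr_add)
  then have "complex_of_real (q powr (- real e / 2) * q powr (- real e / 2) * q ^ e) = 1" by simp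
  then show ?thesis unfolding k by (simp add: algebra_simps)
qed

text \<open>Removing the possibly negative exponent gives t(i) the shape of t'(i), with \<alpha> =
  q^(i + 1) and \<beta> = q^(N - D + 1), so \<open>block_projection\<close> serves both
  operators.\<close>

lemma t_block_upper_right:
  assumes "q > 0" "D \<le> N"
  shows "complex_of_nat q ^ (N - D + 1) * (complex_of_nat q powi (int D - int N + int i) - 1)
    = complex_of_nat q ^ (i + 1) - complex_of_nat q ^ (N - D + 1)"
proof -
  have e: "int (i + 1) = int (N - D + 1) + (int D - int N + int i)" using assms(2) by simp
  have "complex_of_nat q ^ (i + 1) = complex_of_nat q powi int (i + 1)" by (simp only: power_int_of_nat)
  also have "\<dots> = complex_of_nat q ^ (N - D + 1) * complex_of_nat q powi (int D - int N + int i)"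
    unfolding e using assms(1) by (subst power_int_add) (simp_all only: power_int_of_nat, simp)
  finally show ?thesis by (simp only: right_diff_distrib mult_1_right)
qed

theorem theorem7p10:
  fixes q N D :: nat
    and C :: "('f::{field,finite} ^ 'n) set set"
    and x :: "('f ^ 'n) set"
    and k k' :: complex
    and T T' :: "complex ^ ('f ^ 'n) set \<Rightarrow> complex ^ ('f ^ 'n) set"
  assumes q: "q = CARD('f)"
    and N: "N = CARD('n)"
    and D: "D \<ge> 3" "N \<ge> 2 * D"
    and C: "delsarte_clique D C"
    and x: "x \<in> C"
    and k: "k = \<i> * complex_of_real (real q powr ((real D - real N - 1) / 2))"
    and k': "k' = \<i> * complex_of_real (real q powr (- real D / 2))"
    and T: "is_T_action D C x k T"
    and T': "is_T'_action D C x k' T'"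
  shows "\<forall>w \<in> W_space D C x.
           orth_proj (module_generated (grass_bose_mesner D) (char_vec {x})) w
             = inverse (k' + inverse k') *s (T' w + inverse k' *s w)
         \<and> orth_proj (module_generated (grass_bose_mesner D) (char_vec C)) w
             = inverse (k + inverse k) *s (T w + inverse k *s w)"
proof -
  have q1: "real q > 1" using CARD_field_ge_2[where 'f = 'f] q by simp
  have qq: "real q = real CARD('f)" using q by simp
  have D': "D \<ge> 1" "CARD('n) \<ge> 2 * D" using D N by auto
  have xX: "x \<in> grass_vertices D" using C x by (auto simp: delsarte_clique_def)
  note x' = grass_verticesD[OF xX]
  have kk: "k * k * of_real (real q ^ (N - D + 1)) = - 1"
  proof (rule sqrt_minus_power_square)
    have "(real D - real N - 1) / 2 = - real (N - D + 1) / 2" using D by (simp add: of_nat_diff)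
    then show "k = \<i> * complex_of_real (real q powr (- real (N - D + 1) / 2))" unfolding k by simp
  qed (use q1 in simp)
  have kk': "k' * k' * of_real (real q ^ D) = - 1"
    using q1 k' by (intro sqrt_minus_power_square) auto
  have "real q ^ 0 < real q ^ (N - D + 1)" "real q ^ 0 < real q ^ D"
    using q1 D by (intro power_strict_increasing; simp)+
  then have ne: "real q ^ (N - D + 1) \<noteq> 1" "real q ^ D \<noteq> 1" by auto
  show ?thesis
  proof (rule delsarte_clique_cells[OF C D' x qq])
    fix S m assume S: "vec.subspace S" "m = min D (vec.dim S)" "C = layer D S m"
      and ends: "layer D x D = cell_minus D C x 0" "layer D x 0 = cell_plus D C x (D - 1)"
      and un_x: "\<And>i. i \<in> {1..D - 1} \<Longrightarrow> layer D x (D - i) = cell_plus D C x (i - 1) \<union> cell_minus D C x i"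
      and disj_x: "\<And>i. i \<in> {1..D - 1} \<Longrightarrow> cell_plus D C x (i - 1) \<inter> cell_minus D C x i = {}"
      and card_x: "\<And>i. i \<in> {1..D - 1} \<Longrightarrow> real (card (cell_plus D C x (i - 1))) * (real q ^ D - 1)
        = (real q ^ i - 1) * real (card (layer D x (D - i)))"
      and un_C: "\<And>i. i < D \<Longrightarrow> layer D S (m - i) = cell_minus D C x i \<union> cell_plus D C x i"
      and disj_C: "\<And>i. i < D \<Longrightarrow> cell_minus D C x i \<inter> cell_plus D C x i = {}"
      and card_C: "\<And>i. i < D \<Longrightarrow> real (card (cell_minus D C x i)) * (real q ^ (CARD('n) - D + 1) - 1)
        = (real q ^ (i + 1) - 1) * real (card (layer D S (m - i)))"
    let ?G = "\<Union>i<D. {char_vec (cell_minus D C x i), char_vec (cell_plus D C x i)}"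
    have "layer D x D = {x}"
    proof -
      have "U = x" if "U \<in> grass_vertices D" "vec.dim (U \<inter> x) = D" for U
      proof -
        have sub: "vec.subspace (U \<inter> x)" using that(1) x' by (intro vec.subspace_inter) (auto simp: grass_vertices_def)
        have "U \<inter> x = U" "U \<inter> x = x"
          using that sub x' by (intro subspace_eq_if_dim_le; simp add: grass_vertices_def)+
        then show ?thesis by blast
      qed
      then show ?thesis using xX x' by (auto simp: layer_def)
    qed
    then have Mx: "module_generated (grass_bose_mesner D) (char_vec {x}) = layer_span D x"
      using module_generated_layer[OF x'(1), of D D] x'(2) by simp
    have MC: "module_generated (grass_bose_mesner D) (char_vec C) = layer_span D S"
      using module_generated_layer[OF S(1,2)] S(3) by simp
    have sub: "vec.subspace (layer_span D R)" for R :: "('f ^ 'n) set" by (simp add: layer_span_def)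
    let ?p' = "\<lambda>u. inverse (k' + inverse k') *s (T' u + inverse k' *s u)"
    let ?p = "\<lambda>u. inverse (k + inverse k) *s (T u + inverse k *s u)"
    \<comment> \<open>For the two \<open>1 \<times> 1\<close> blocks the cell is an entire layer,
      hence fixed by the projection, and the eigenvalue \<open>k'\<close> is normalised to
      1.\<close>
    have single: "?p' (char_vec (layer D x j)) \<in> layer_span D x \<and>
        (\<forall>s\<in>layer_span D x. hermitian_inner (char_vec (layer D x j) - ?p' (char_vec (layer D x j))) s = 0)"
      if "T' (char_vec (layer D x j)) = k' *s char_vec (layer D x j)" for j
    proof -
      have "k' \<noteq> 0" using kk' by auto
      have "k' + inverse k' \<noteq> 0"
      proof
        assume "k' + inverse k' = 0"
        then have "inverse k' = - k'" by (simp add: eq_neg_iff_add_eq_0 add.commute)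
        then have "k' * k' = - 1" using \<open>k' \<noteq> 0\<close> by (metis minus_minus mult_minus_right right_inverse)
        then have "complex_of_real (real q ^ D) = 1" using kk' by simp
        then show False using ne(2) by (simp only: of_real_eq_1_iff)
      qed
      then have "?p' (char_vec (layer D x j)) = 1 *s char_vec (layer D x j)"
        unfolding that by (simp flip: vector_sadd_rdistrib)
      then show ?thesis using layer_projection[of "layer D x j" D x j 1] by auto
    qed
    have gen': "?p' u \<in> layer_span D x \<and> (\<forall>s\<in>layer_span D x. hermitian_inner (u - ?p' u) s = 0)" if u: "u \<in> ?G" for u
    proof -
      have block: ?thesis if i: "i \<in> {1..D - 1}"
        and ui: "u = char_vec (cell_plus D C x (i - 1)) \<or> u = char_vec (cell_minus D C x i)" for i
      proof -
        have act: "acts_by_block T' (t'_block q D k' i) (char_vec (cell_plus D C x (i - 1))) (char_vec (cell_minus D C x i))"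
          using T' i q by (simp add: is_T'_action_def)
        show ?thesis
          using block_projection[OF un_x[OF i] disj_x[OF i] card_x[OF i] ne(2) kk' _ _ ui, of T'] act
          by (simp add: acts_by_block_def t'_block_def Let_def)
      qed
      obtain i where i: "i < D" "u = char_vec (cell_minus D C x i) \<or> u = char_vec (cell_plus D C x i)"
        using u by blast
      \<comment> \<open>A minus cell of index \<open>i\<close> belongs to block \<open>i\<close>, a
        plus cell of index \<open>i\<close> to block \<open>i + 1\<close>; only the first minus cell
        and the last plus cell have no partner.\<close>
      consider "u = char_vec (cell_minus D C x 0)" | "u = char_vec (cell_plus D C x (D - 1))"
        | j where "j \<in> {1..D - 1}" "u = char_vec (cell_plus D C x (j - 1)) \<or> u = char_vec (cell_minus D C x j)"
      proof (cases "u = char_vec (cell_minus D C x i)")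
        case True
        then show thesis using i that(1) that(3)[of i] by (cases "i = 0") auto
      next
        case False
        then show thesis using i that(2) that(3)[of "Suc i"] by (cases "i = D - 1") auto
      qed
      then show ?thesis
      proof cases
        case 1
        then show ?thesis using single[of D] T' ends by (simp add: is_T'_action_def)
      next
        case 2
        then show ?thesis using single[of 0] T' ends by (simp add: is_T'_action_def)
      next
        case 3
        then show ?thesis by (rule block)
      qed
    qed
    have gen: "?p u \<in> layer_span D S \<and> (\<forall>s\<in>layer_span D S. hermitian_inner (u - ?p u) s = 0)" if u: "u \<in> ?G" for u
    proof -
      obtain i where i: "i < D" "u = char_vec (cell_minus D C x i) \<or> u = char_vec (cell_plus D C x i)"
        using u by blast
      have "acts_by_block T (t_block q N D k i) (char_vec (cell_minus D C x i)) (char_vec (cell_plus D C x i))"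
        using T i(1) q N by (simp add: is_T_action_def)
      then have act: "T (char_vec (cell_minus D C x i))
          = (k * (1 - of_real (real q ^ (i + 1)) + of_real (real q ^ (N - D + 1)))) *s char_vec (cell_minus D C x i)
            + (k * (1 - of_real (real q ^ (i + 1)))) *s char_vec (cell_plus D C x i)"
        "T (char_vec (cell_plus D C x i))
          = (k * (of_real (real q ^ (i + 1)) - of_real (real q ^ (N - D + 1)))) *s char_vec (cell_minus D C x i)
            + (k * of_real (real q ^ (i + 1))) *s char_vec (cell_plus D C x i)"
        using t_block_upper_right[of q D N i] q1 D
        by (simp_all add: acts_by_block_def t_block_def Let_def)
      show ?thesis
        using block_projection[OF un_C[OF i(1)] disj_C[OF i(1)] card_C[OF i(1), folded N] ne(1) kk act i(2)]
        by blast
    qed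
    have endo: "linear_endo_on (vec.span ?G) T'" "linear_endo_on (vec.span ?G) T"
      using T T' by (simp_all add: is_T_action_def is_T'_action_def W_space_def)
    show ?thesis
      unfolding Mx MC W_space_def
    proof (intro ballI conjI)
      fix w assume w: "w \<in> vec.span ?G"
      show "orth_proj (layer_span D x) w = ?p' w"
        by (rule orth_proj_eq_on_span[OF sub endo(1) _ _ w]) (use gen' in blast)+
      show "orth_proj (layer_span D S) w = ?p w"
        by (rule orth_proj_eq_on_span[OF sub endo(2) _ _ w]) (use gen in blast)+
    qed
  qed
qed

end
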